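(* Let $d\ge1$ and $L\ge2$. The Poisson algebra $\mathcal Y_{d,L}$ is a deformation of the Poisson algebra $S(\mathfrak g_{d,L})$ (equivalently, the latter is a degeneration of the former) in the following sense: the Poisson brackets $\{-,-\mid h\}$ on the commutative algebra $\mathcal Y_{d,L}$, indexed by $h\in\mathbb C^*$ and defined in the context, are such that $\{-,-\mid 1\}$ is the initial bracket of $\mathcal Y_{d,L}$, while in the limit as $h\to0$ (coefficientwise with respect to the basis of monomials in the generators $p_{ij}(z)$) one gets a Poisson algebra isomorphic to the Poisson algebra $S(\mathfrak g_{d,L})$.
   Context: The ground field is $\mathbb C$. $W_L$ is the set of nonempty words in the alphabet $[L]=\{1,\dots,L\}$; $\ell(z)$ is the length of $z$. The Poisson algebra $\mathcal Y_{d,L}$: as a commutative algebra it is freely generated by elements $p_{ij}(z)$, $1\le i,j\le d$, $z\in W_L$, and its bracket is determined by $$\{p_{ij}(z),p_{kl}(w)\}=\sum_{r=1}^m\sum_{q=1}^n\delta_{z_r,w_q}\bigl(p_{kj}(w_1\dots w_{q-1}z_{r+1}\dots z_m)p_{il}(z_1\dots z_rw_{q+1}\dots w_n)-p_{kj}(w_1\dots w_{q-1}z_r\dots z_m)p_{il}(z_1\dots z_{r-1}w_{q+1}\dots w_n)\bigr)$$ for $z=z_1\dots z_m$, $w=w_1\dots w_n$, with $p_{ab}(\varnothing):=\delta_{ab}$. (It arises as the Poisson subalgebra generated by the $p_{ij}(z)$ in the graded algebra $P_{d,L}=\varprojlim S(\mathfrak{gl}(N,\mathbb C)^{\oplus L})^{\operatorname{diag}\mathfrak{gl}_d(N,\mathbb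 C)}$, where $p_{ij}(z)$ is given by the sequence $\sum_{a_1,\dots,a_{m-1}=1}^NE_{ia_1\mid z_1}E_{a_1a_2\mid z_2}\cdots E_{a_{m-1}j\mid z_m}$, with $E_{ab\mid\alpha}$ the matrix unit in the $\alpha$-th copy of $\mathfrak{gl}(N,\mathbb C)$.) For $h\in\mathbb C^*$, let $\phi_h$ be the automorphism of the commutative algebra $\mathcal Y_{d,L}$ with $\phi_h(p_{ij}(z))=h^{1-\ell(z)}p_{ij}(z)$, and set $\{x,y\mid h\}:=\phi_h(\{\phi_h^{-1}(x),\phi_h^{-1}(y)\})$. The Lie algebra $\mathfrak g_{d,L}$: on the vector space $\mathbb C[W_L]$ with basis $W_L$ define the associative product $z\odot w:=z_1\dots z_{m-1}z_mw_2\dots w_n$ if $z_m=w_1$, and $z\odot w:=0$ otherwise, for $z=z_1\dots z_m$, $w=w_1\dots w_n$; denote the resulting associative algebra by $R_L$. Then $\mathfrak g_{d,L}$ is the associative algebra $\operatorname{End}(\mathbb C^d)\otimes R_L$ regarded as a Lie algebra with the commutator bracket. $S(\mathfrak g_{d,L})$ is its symmetric algebra with the canonical Poisson bracket extending the Lie bracket. *)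

theory Defs
  imports "HOL-Analysis.Analysis" "HOL-Library.Poly_Mapping"
begin

section \<open>Commutative algebras and Poisson algebras over the complex numbers\<close>

locale comm_algebra = vector_space scale
  for scale :: "complex \<Rightarrow> 'a::comm_ring_1 \<Rightarrow> 'a" +
  assumes scale_mult_left: "scale c x * y = scale c (x * y)"

locale biderivation = comm_algebra scale
  for scale :: "complex \<Rightarrow> 'a::comm_ring_1 \<Rightarrow> 'a" +
  fixes br :: "'a \<Rightarrow> 'a \<Rightarrow> 'a"
  assumes br_add_left: "br (x + y) z = br x z + br y z"
    and br_scale_left: "br (scale c x) z = scale c (br x z)"
    and br_add_right: "br z (x + y) = br z x + br z y"
    and br_scale_right: "br z (scale c x) = scale c (br z x)"
    and br_mult_left: "br (x * y) z = x * br y z + br x z * y"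
    and br_mult_right: "br z (x * y) = x * br z y + br z x * y"

locale poisson_algebra = biderivation scale br
  for scale :: "complex \<Rightarrow> 'a::comm_ring_1 \<Rightarrow> 'a" and br :: "'a \<Rightarrow> 'a \<Rightarrow> 'a" +
  assumes br_self: "br x x = 0"
    and jacobi: "br x (br y z) + br y (br z x) + br z (br x y) = 0"

definition alg_hom ::
  "(complex \<Rightarrow> 'a::comm_ring_1 \<Rightarrow> 'a) \<Rightarrow> (complex \<Rightarrow> 'b::comm_ring_1 \<Rightarrow> 'b) \<Rightarrow> ('a \<Rightarrow> 'b) \<Rightarrow> bool" where
  "alg_hom s1 s2 f \<longleftrightarrow>
     Vector_Spaces.linear s1 s2 f \<and> f 1 = 1 \<and> (\<forall>x y. f (x * y) = f x * f y)"

definition poisson_isomorphic ::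
  "(complex \<Rightarrow> 'a::comm_ring_1 \<Rightarrow> 'a) \<Rightarrow> ('a \<Rightarrow> 'a \<Rightarrow> 'a) \<Rightarrow>
   (complex \<Rightarrow> 'b::comm_ring_1 \<Rightarrow> 'b) \<Rightarrow> ('b \<Rightarrow> 'b \<Rightarrow> 'b) \<Rightarrow> bool" where
  "poisson_isomorphic s1 b1 s2 b2 \<longleftrightarrow>
     (\<exists>f :: 'a \<Rightarrow> 'b.
        bij f \<and> alg_hom s1 s2 f \<and> (\<forall>x y. f (b1 x y) = b2 (f x) (f y)))"


section \<open>Free vector spaces and polynomial algebras\<close>

text \<open>The vector space with basis \<open>'b\<close> is \<open>'b \<Rightarrow>\<^sub>0 complex\<close>. Polynomials are a special case:
  the space whose basis consists of the monomials, i.e. of the finitely supported exponent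
  vectors \<open>'v \<Rightarrow>\<^sub>0 nat\<close>. The coefficient of the monomial \<open>m\<close> in \<open>f\<close> is \<open>lookup f m\<close>.\<close>

definition pscale :: "complex \<Rightarrow> ('b \<Rightarrow>\<^sub>0 complex) \<Rightarrow> ('b \<Rightarrow>\<^sub>0 complex)" where
  "pscale c x = Poly_Mapping.map ((*) c) x"

definition bilinear_ext ::
  "('a \<Rightarrow> 'b \<Rightarrow> ('c \<Rightarrow>\<^sub>0 complex)) \<Rightarrow> ('a \<Rightarrow>\<^sub>0 complex) \<Rightarrow> ('b \<Rightarrow>\<^sub>0 complex) \<Rightarrow> ('c \<Rightarrow>\<^sub>0 complex)" where
  "bilinear_ext \<beta> x y =
     (\<Sum>a\<in>Poly_Mapping.keys x. \<Sum>b\<in>Poly_Mapping.keys y.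
        pscale (Poly_Mapping.lookup x a * Poly_Mapping.lookup y b) (\<beta> a b))"

type_synonym 'v mpoly = "('v \<Rightarrow>\<^sub>0 nat) \<Rightarrow>\<^sub>0 complex"

definition Var :: "'v \<Rightarrow> 'v mpoly" where
  "Var v = Poly_Mapping.single (Poly_Mapping.single v 1) 1"

definition mono_eval :: "('v \<Rightarrow> 'a::comm_ring_1) \<Rightarrow> ('v \<Rightarrow>\<^sub>0 nat) \<Rightarrow> 'a" where
  "mono_eval \<sigma> m = (\<Prod>v\<in>Poly_Mapping.keys m. \<sigma> v ^ Poly_Mapping.lookup m v)"

definition poly_eval ::
  "(complex \<Rightarrow> 'a::comm_ring_1 \<Rightarrow> 'a) \<Rightarrow> ('v \<Rightarrow> 'a) \<Rightarrow> 'v mpoly \<Rightarrow> 'a" where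
  "poly_eval sc \<sigma> f =
     (\<Sum>m\<in>Poly_Mapping.keys f. sc (Poly_Mapping.lookup f m) (mono_eval \<sigma> m))"

definition partial :: "'v \<Rightarrow> 'v mpoly \<Rightarrow> 'v mpoly" where
  "partial v f = (\<Sum>m\<in>Poly_Mapping.keys f.
     Poly_Mapping.single (m - Poly_Mapping.single v 1)
       (of_nat (Poly_Mapping.lookup m v) * Poly_Mapping.lookup f m))"

definition pvars :: "'v mpoly \<Rightarrow> 'v set" where
  "pvars f = (\<Union>m\<in>Poly_Mapping.keys f. Poly_Mapping.keys m)"

text \<open>The bracket on a polynomial algebra determined by its values \<open>c u v\<close> on the variables;
  see \<open>biderivation_poly_bracket\<close>, \<open>poly_bracket_Var\<close> and \<open>poly_bracket_unique\<close> below.\<close>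

definition poly_bracket :: "('v \<Rightarrow> 'v \<Rightarrow> 'v mpoly) \<Rightarrow> 'v mpoly \<Rightarrow> 'v mpoly \<Rightarrow> 'v mpoly" where
  "poly_bracket c f g = (\<Sum>u\<in>pvars f. \<Sum>v\<in>pvars g. partial u f * partial v g * c u v)"


section \<open>Words\<close>

typedef 'l nonempty_word = "{z :: 'l list. z \<noteq> []}"
  morphisms letters Word
  by auto


section \<open>The Poisson algebra of the generators \<open>p\<^sub>i\<^sub>j(z)\<close>\<close>

text \<open>The index set \<open>{1..d}\<close> and the alphabet \<open>{1..L}\<close> are rendered by finite types \<open>'d\<close> and
  \<open>'l\<close> with \<open>d = CARD('d)\<close> and \<open>L = CARD('l)\<close>.\<close>

datatype ('d, 'l) generator = Gen 'd 'd "'l nonempty_word"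

type_synonym ('d, 'l) Y = "('d, 'l) generator mpoly"

definition pgen :: "'d \<Rightarrow> 'd \<Rightarrow> 'l list \<Rightarrow> ('d, 'l) Y" where
  "pgen i j z = (if z = [] then (if i = j then 1 else 0) else Var (Gen i j (Word z)))"

text \<open>Positions are counted from \<open>1\<close>, so the \<open>r\<close>-th letter of \<open>z\<close> is \<open>z ! (r - 1)\<close>.\<close>

definition gen_bracket ::
  "'d \<Rightarrow> 'd \<Rightarrow> 'l list \<Rightarrow> 'd \<Rightarrow> 'd \<Rightarrow> 'l list \<Rightarrow> ('d, 'l) Y" where
  "gen_bracket i j z k l w =
     (\<Sum>r = 1..length z. \<Sum>q = 1..length w.
        if z ! (r - 1) = w ! (q - 1)
        then pgen k j (take (q - 1) w @ drop r z) * pgen i l (take r z @ drop q w)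
           - pgen k j (take (q - 1) w @ drop (r - 1) z) * pgen i l (take (r - 1) z @ drop q w)
        else 0)"

definition Y_bracket :: "('d, 'l) Y \<Rightarrow> ('d, 'l) Y \<Rightarrow> ('d, 'l) Y" where
  "Y_bracket = poly_bracket
     (\<lambda>u v. case u of Gen i j z \<Rightarrow> case v of Gen k l w \<Rightarrow>
        gen_bracket i j (letters z) k l (letters w))"

definition phi :: "complex \<Rightarrow> ('d, 'l) Y \<Rightarrow> ('d, 'l) Y" where
  "phi h = poly_eval pscale
     (\<lambda>u. case u of Gen i j z \<Rightarrow> pscale (h powi (1 - int (length (letters z)))) (Var (Gen i j z)))"

definition Y_bracket_h :: "complex \<Rightarrow> ('d, 'l) Y \<Rightarrow> ('d, 'l) Y \<Rightarrow> ('d, 'l) Y" where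
  "Y_bracket_h h x y = phi h (Y_bracket (inv (phi h) x) (inv (phi h) y))"


section \<open>The Lie algebra \<open>\<gg>\<close> and its symmetric algebra\<close>

type_synonym 'l R = "'l nonempty_word \<Rightarrow>\<^sub>0 complex"

definition word_prod :: "'l nonempty_word \<Rightarrow> 'l nonempty_word \<Rightarrow> 'l R" where
  "word_prod z w =
     (if last (letters z) = hd (letters w)
      then Poly_Mapping.single (Word (letters z @ tl (letters w))) 1
      else 0)"

definition R_mult :: "'l R \<Rightarrow> 'l R \<Rightarrow> 'l R" where
  "R_mult = bilinear_ext word_prod"

text \<open>The space \<open>End(\<complex>\<^sup>d) \<otimes> R\<close> has the basis \<open>E\<^sub>i\<^sub>j \<otimes> z\<close>, encoded by the triples \<open>(i, j, z)\<close>,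
  and multiplication \<open>(E\<^sub>i\<^sub>j \<otimes> z)(E\<^sub>k\<^sub>l \<otimes> w) = \<delta>\<^sub>j\<^sub>k E\<^sub>i\<^sub>l \<otimes> (z \<odot> w)\<close>.
  See \<open>g_mult_tensor\<close> for the multiplication of arbitrary elementary tensors.\<close>

type_synonym ('d, 'l) g = "('d \<times> 'd \<times> 'l nonempty_word) \<Rightarrow>\<^sub>0 complex"

definition unit_tensor :: "'d \<Rightarrow> 'd \<Rightarrow> 'l R \<Rightarrow> ('d, 'l) g" where
  "unit_tensor i j a =
     (\<Sum>z\<in>Poly_Mapping.keys a. Poly_Mapping.single (i, j, z) (Poly_Mapping.lookup a z))"

definition tensor :: "complex ^ 'd ^ 'd \<Rightarrow> 'l R \<Rightarrow> ('d::finite, 'l) g" where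
  "tensor A a = (\<Sum>i\<in>UNIV. \<Sum>j\<in>UNIV. pscale (A $ i $ j) (unit_tensor i j a))"

definition g_mult :: "('d, 'l) g \<Rightarrow> ('d, 'l) g \<Rightarrow> ('d, 'l) g" where
  "g_mult = bilinear_ext
     (\<lambda>(i, j, z) (k, l, w). if j = k then unit_tensor i l (word_prod z w) else 0)"

definition g_lie :: "('d, 'l) g \<Rightarrow> ('d, 'l) g \<Rightarrow> ('d, 'l) g" where
  "g_lie x y = g_mult x y - g_mult y x"

text \<open>The symmetric algebra of the vector space \<open>'b \<Rightarrow>\<^sub>0 complex\<close> is realised as the polynomial
  algebra on its basis, with \<open>sym_incl\<close> as the canonical linear map into it; the universal
  property is \<open>sym_universal\<close> below.\<close>

definition sym_incl :: "('b \<Rightarrow>\<^sub>0 complex) \<Rightarrow> 'b mpoly" where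
  "sym_incl x = (\<Sum>b\<in>Poly_Mapping.keys x. pscale (Poly_Mapping.lookup x b) (Var b))"

definition sym_bracket ::
  "(('b \<Rightarrow>\<^sub>0 complex) \<Rightarrow> ('b \<Rightarrow>\<^sub>0 complex) \<Rightarrow> ('b \<Rightarrow>\<^sub>0 complex)) \<Rightarrow>
   'b mpoly \<Rightarrow> 'b mpoly \<Rightarrow> 'b mpoly" where
  "sym_bracket lie = poly_bracket
     (\<lambda>a b. sym_incl (lie (Poly_Mapping.single a 1) (Poly_Mapping.single b 1)))"

type_synonym ('d, 'l) Sg = "('d \<times> 'd \<times> 'l nonempty_word) mpoly"

definition Sg_bracket :: "('d, 'l) Sg \<Rightarrow> ('d, 'l) Sg \<Rightarrow> ('d, 'l) Sg" where
  "Sg_bracket = sym_bracket g_lie"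

section \<open>Basic properties\<close>

lemma lookup_pscale [simp]:
  "Poly_Mapping.lookup (pscale c x) b = c * Poly_Mapping.lookup x b"
  by (simp add: pscale_def Poly_Mapping.map.rep_eq when_def)

lemma pscale_single: "pscale c (Poly_Mapping.single b a) = Poly_Mapping.single b (c * a)"
  by (rule poly_mapping_eqI) (simp add: lookup_single when_def)

lemma pscale_0 [simp]: "pscale 0 x = 0" "pscale c 0 = 0"
  by (auto intro!: poly_mapping_eqI)

lemma pscale_add_left: "pscale (c + d) x = pscale c x + pscale d x"
  and pscale_add_right: "pscale c (x + y) = pscale c x + pscale c y"
  and pscale_diff_right: "pscale c (x - y) = pscale c x - pscale c y"
  and pscale_pscale: "pscale c (pscale d x) = pscale (c * d) x"
  and pscale_sum: "pscale c (\<Sum>s\<in>S. f s) = (\<Sum>s\<in>S. pscale c (f s))"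
  by (auto intro!: poly_mapping_eqI
      simp: lookup_add lookup_minus lookup_sum sum_distrib_left algebra_simps)

lemma vector_space_pscale: "vector_space (pscale :: complex \<Rightarrow> ('b \<Rightarrow>\<^sub>0 complex) \<Rightarrow> _)"
  by unfold_locales (auto intro!: poly_mapping_eqI simp: lookup_add algebra_simps)

lemma pscale_conv_mult:
  "pscale c (f :: 'v mpoly) = Poly_Mapping.single 0 c * f"
  unfolding pscale_def by (rule mult_map_scale_conv_mult)

lemma comm_algebra_pscale: "comm_algebra (pscale :: complex \<Rightarrow> 'v mpoly \<Rightarrow> 'v mpoly)"
proof -
  interpret vector_space "pscale :: complex \<Rightarrow> 'v mpoly \<Rightarrow> 'v mpoly"
    by (rule vector_space_pscale)
  show ?thesis
    by unfold_locales (simp add: pscale_conv_mult mult.assoc)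
qed

lemma poly_mapping_sum_singles:
  "(\<Sum>m\<in>Poly_Mapping.keys f. Poly_Mapping.single m (Poly_Mapping.lookup f m)) = f"
  by (rule poly_mapping_eqI)
     (simp add: lookup_sum lookup_single when_def in_keys_iff)

lemma poly_mapping_additive_induct [case_names single add]:
  assumes single: "\<And>m c. P (Poly_Mapping.single m c)"
    and add: "\<And>f g. P f \<Longrightarrow> P g \<Longrightarrow> P (f + g)"
  shows "P (f :: 'b \<Rightarrow>\<^sub>0 complex)"
proof -
  have "P (\<Sum>m\<in>S. Poly_Mapping.single m (Poly_Mapping.lookup f m))" if "finite S" for S
    using that
  proof (induction S)
    case empty
    have "P (Poly_Mapping.single undefined 0)" by (rule single)
    then show ?case by simp
  qed (simp add: single add)
  from this[of "Poly_Mapping.keys f"] show ?thesis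
    by (simp add: poly_mapping_sum_singles)
qed

lemma Var_power: "Var v ^ n = Poly_Mapping.single (Poly_Mapping.single v n) 1"
  by (induction n) (auto simp: Var_def mult_single simp flip: single_add)

lemma prod_single_one:
  "(\<Prod>v\<in>S. Poly_Mapping.single (h v) (1::complex)) = Poly_Mapping.single (\<Sum>v\<in>S. h v) 1"
  by (induction S rule: infinite_finite_induct) (auto simp: mult_single)

lemma poly_mapping_sum_singles_nat:
  "(\<Sum>v\<in>Poly_Mapping.keys m. Poly_Mapping.single v (Poly_Mapping.lookup m v)) = (m :: 'v \<Rightarrow>\<^sub>0 nat)"
  by (rule poly_mapping_eqI)
     (simp add: lookup_sum lookup_single when_def in_keys_iff)

lemma monomial_eq_prod_Var: "Poly_Mapping.single m 1 = mono_eval Var m"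
  by (simp add: mono_eval_def Var_power prod_single_one poly_mapping_sum_singles_nat)

lemma mpoly_induct [case_names one Var scale add mult]:
  assumes one: "P 1" and Var: "\<And>v. P (Var v)"
    and scale: "\<And>c f. P f \<Longrightarrow> P (pscale c f)"
    and add: "\<And>f g. P f \<Longrightarrow> P g \<Longrightarrow> P (f + g)"
    and mult: "\<And>f g. P f \<Longrightarrow> P g \<Longrightarrow> P (f * g)"
  shows "P (f :: 'v mpoly)"
proof (induction f rule: poly_mapping_additive_induct)
  case (single m c)
  have pow: "P (Var v ^ n)" for v n
    by (induction n) (auto intro: one Var mult)
  have "P (\<Prod>v\<in>S. Var v ^ Poly_Mapping.lookup m v)" if "finite S" for S
    using that by induction (auto intro: one mult pow)
  then have "P (Poly_Mapping.single m 1)"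
    by (simp add: monomial_eq_prod_Var mono_eval_def)
  from scale[OF this, of c] show ?case by (simp add: pscale_single)
qed (rule add)

lemma mono_eval_superset:
  assumes "finite S" "Poly_Mapping.keys m \<subseteq> S"
  shows "mono_eval \<sigma> m = (\<Prod>v\<in>S. \<sigma> v ^ Poly_Mapping.lookup m v)"
  unfolding mono_eval_def using assms
  by (intro prod.mono_neutral_left) (auto simp: in_keys_iff)

lemma mono_eval_add: "mono_eval \<sigma> (m + n) = mono_eval \<sigma> m * mono_eval \<sigma> n"
proof -
  let ?S = "Poly_Mapping.keys m \<union> Poly_Mapping.keys n"
  have "Poly_Mapping.keys (m + n) \<subseteq> ?S" by (rule Poly_Mapping.keys_add)
  then show ?thesis
    by (simp add: mono_eval_superset[of ?S] lookup_add power_add prod.distrib)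
qed

lemma mono_eval_0 [simp]: "mono_eval \<sigma> 0 = 1"
  by (simp add: mono_eval_def)

lemma mono_eval_single [simp]: "mono_eval \<sigma> (Poly_Mapping.single v 1) = \<sigma> v"
  by (simp add: mono_eval_def)

context comm_algebra
begin

lemma scale_mult_right: "x * scale c y = scale c (x * y)"
  by (metis mult.commute scale_mult_left)

lemma poly_eval_superset:
  assumes "finite S" "Poly_Mapping.keys f \<subseteq> S"
  shows "poly_eval scale \<sigma> f = (\<Sum>m\<in>S. scale (Poly_Mapping.lookup f m) (mono_eval \<sigma> m))"
  unfolding poly_eval_def using assms
  by (intro sum.mono_neutral_left) (auto simp: in_keys_iff)

lemma poly_eval_add: "poly_eval scale \<sigma> (f + g) = poly_eval scale \<sigma> f + poly_eval scale \<sigma> g"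
proof -
  let ?S = "Poly_Mapping.keys f \<union> Poly_Mapping.keys g"
  have "Poly_Mapping.keys (f + g) \<subseteq> ?S" by (rule Poly_Mapping.keys_add)
  then show ?thesis
    by (simp add: poly_eval_superset[of ?S] lookup_add scale_left_distrib sum.distrib)
qed

lemma poly_eval_pscale: "poly_eval scale \<sigma> (pscale c f) = scale c (poly_eval scale \<sigma> f)"
proof -
  have "Poly_Mapping.keys (pscale c f) \<subseteq> Poly_Mapping.keys f"
    by (auto simp: in_keys_iff)
  then show ?thesis
    by (simp add: poly_eval_superset[of "Poly_Mapping.keys f"] scale_sum_right)
qed

lemma poly_eval_single:
  "poly_eval scale \<sigma> (Poly_Mapping.single m c) = scale c (mono_eval \<sigma> m)"
  by (simp add: poly_eval_superset[of "{m}"])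

lemma poly_eval_1: "poly_eval scale \<sigma> 1 = 1"
  unfolding single_one[symmetric] by (simp only: poly_eval_single mono_eval_0 scale_one)

lemma poly_eval_Var: "poly_eval scale \<sigma> (Var v) = \<sigma> v"
  unfolding Var_def by (simp only: poly_eval_single mono_eval_single scale_one)

lemma poly_eval_mult: "poly_eval scale \<sigma> (f * g) = poly_eval scale \<sigma> f * poly_eval scale \<sigma> g"
proof (induction f rule: poly_mapping_additive_induct)
  case (single m c)
  show ?case
    by (induction g rule: poly_mapping_additive_induct)
       (simp_all add: mult_single poly_eval_single mono_eval_add scale_mult_left
          scale_mult_right poly_eval_add algebra_simps)
qed (simp add: poly_eval_add distrib_right)

lemma alg_hom_poly_eval: "alg_hom pscale scale (poly_eval scale \<sigma>)"
proof -
  interpret A: vector_space "pscale :: complex \<Rightarrow> 'v mpoly \<Rightarrow> 'v mpoly"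
    by (rule vector_space_pscale)
  show ?thesis
    unfolding alg_hom_def Vector_Spaces.linear_iff
    by (intro conjI allI A.vector_space_axioms vector_space_axioms poly_eval_add
        poly_eval_pscale poly_eval_1 poly_eval_mult)
qed

end

lemma alg_hom_simps:
  assumes "alg_hom s1 s2 F"
  shows "F (x + y) = F x + F y" "F (s1 c x) = s2 c (F x)" "F 1 = 1" "F (x * y) = F x * F y"
  using assms unfolding alg_hom_def Vector_Spaces.linear_iff by auto

lemma alg_hom_mpoly_unique:
  assumes "alg_hom pscale s F" "alg_hom pscale s G" "\<And>v. F (Var v) = G (Var v)"
  shows "F f = G f"
  by (induction f rule: mpoly_induct)
     (simp_all add: assms(3) alg_hom_simps[OF assms(1)] alg_hom_simps[OF assms(2)])


subsection \<open>The bracket on a polynomial algebra\<close>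

lemma poly_mapping_minus_single_add:
  "Poly_Mapping.lookup m v \<noteq> 0 \<Longrightarrow> m - Poly_Mapping.single v (1::nat) + Poly_Mapping.single v 1 = m"
  by (rule poly_mapping_eqI) (auto simp: lookup_add lookup_minus lookup_single when_def)

lemma lookup_partial:
  "Poly_Mapping.lookup (partial v f) m =
     of_nat (Poly_Mapping.lookup m v + 1) * Poly_Mapping.lookup f (m + Poly_Mapping.single v 1)"
proof -
  let ?s = "Poly_Mapping.single v (1::nat)"
  have aux: "(of_nat (Poly_Mapping.lookup n v) * Poly_Mapping.lookup f n when n - ?s = m) =
      (if n = m + ?s then of_nat (Poly_Mapping.lookup n v) * Poly_Mapping.lookup f n else 0)" for n
  proof (cases "Poly_Mapping.lookup n v = 0")
    case False
    then have "n - ?s = m \<longleftrightarrow> n = m + ?s"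
      using poly_mapping_minus_single_add[of n v] by (metis add_diff_cancel_right')
    then show ?thesis by (simp add: when_def)
  qed (auto simp: lookup_add)
  have "Poly_Mapping.lookup (partial v f) m = (\<Sum>n\<in>Poly_Mapping.keys f.
      if n = m + ?s then of_nat (Poly_Mapping.lookup n v) * Poly_Mapping.lookup f n else 0)"
    unfolding partial_def lookup_sum lookup_single aux ..
  also have "\<dots> = of_nat (Poly_Mapping.lookup m v + 1) * Poly_Mapping.lookup f (m + ?s)"
    by (simp add: in_keys_iff lookup_add)
  finally show ?thesis .
qed

lemma partial_add: "partial v (f + g) = partial v f + partial v g"
  by (rule poly_mapping_eqI) (simp add: lookup_partial lookup_add algebra_simps)

lemma partial_pscale: "partial v (pscale c f) = pscale c (partial v f)"
  by (rule poly_mapping_eqI) (simp add: lookup_partial)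

lemma partial_single:
  "partial v (Poly_Mapping.single m c) =
     Poly_Mapping.single (m - Poly_Mapping.single v 1) (of_nat (Poly_Mapping.lookup m v) * c)"
  by (cases "c = 0") (simp_all add: partial_def)

lemma partial_Var: "partial v (Var u) = (if u = v then 1 else 0)"
  by (simp add: Var_def partial_single lookup_single when_def)

lemma partial_mult_single:
  "partial v (Poly_Mapping.single m a * Poly_Mapping.single n b) =
     Poly_Mapping.single m a * partial v (Poly_Mapping.single n b) +
     partial v (Poly_Mapping.single m a) * Poly_Mapping.single n b"
proof -
  let ?s = "Poly_Mapping.single v (1::nat)"
  have sub: "x + (y - ?s) = x + y - ?s" if "Poly_Mapping.lookup y v \<noteq> 0" for x y :: "'a \<Rightarrow>\<^sub>0 nat"
    using that by (intro poly_mapping_eqI) (auto simp: lookup_add lookup_minus lookup_single when_def)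
  have 1: "Poly_Mapping.single m a * partial v (Poly_Mapping.single n b) =
      Poly_Mapping.single (m + n - ?s) (a * (of_nat (Poly_Mapping.lookup n v) * b))"
  proof (cases "Poly_Mapping.lookup n v = 0")
    case False
    show ?thesis unfolding partial_single mult_single sub[OF False] ..
  qed (simp add: partial_single)
  have 2: "partial v (Poly_Mapping.single m a) * Poly_Mapping.single n b =
      Poly_Mapping.single (m + n - ?s) (of_nat (Poly_Mapping.lookup m v) * a * b)"
  proof (cases "Poly_Mapping.lookup m v = 0")
    case False
    have "m - ?s + n = m + n - ?s"
      using sub[OF False, of n] by (metis add.commute)
    then show ?thesis unfolding partial_single mult_single by simp
  qed (simp add: partial_single)
  show ?thesis
    unfolding 1 2
    unfolding mult_single partial_single lookup_add single_add[symmetric]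
    by (simp only: of_nat_add distrib_left distrib_right mult_ac add_ac)
qed

lemma partial_mult: "partial v (f * g) = f * partial v g + partial v f * g"
proof (induction f rule: poly_mapping_additive_induct)
  case (single m c)
  show ?case
    by (induction g rule: poly_mapping_additive_induct)
       (simp_all add: partial_mult_single partial_add algebra_simps)
qed (simp add: partial_add algebra_simps)

lemma finite_pvars [simp]: "finite (pvars f)"
  by (simp add: pvars_def)

lemma partial_eq_0: "v \<notin> pvars f \<Longrightarrow> partial v f = 0"
  unfolding partial_def pvars_def by (intro sum.neutral) (auto simp: in_keys_iff)

lemma poly_bracket_superset:
  assumes "finite S" "pvars f \<subseteq> S" "finite T" "pvars g \<subseteq> T"
  shows "poly_bracket c f g = (\<Sum>u\<in>S. \<Sum>v\<in>T. partial u f * partial v g * c u v)"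
proof -
  have "poly_bracket c f g = (\<Sum>u\<in>pvars f. \<Sum>v\<in>T. partial u f * partial v g * c u v)"
    unfolding poly_bracket_def using assms
    by (intro sum.cong refl sum.mono_neutral_left) (auto simp: partial_eq_0)
  also have "\<dots> = (\<Sum>u\<in>S. \<Sum>v\<in>T. partial u f * partial v g * c u v)"
    using assms by (intro sum.mono_neutral_left) (auto simp: partial_eq_0)
  finally show ?thesis .
qed

lemma biderivation_poly_bracket: "biderivation pscale (poly_bracket c)"
proof -
  interpret comm_algebra "pscale :: complex \<Rightarrow> 'a mpoly \<Rightarrow> 'a mpoly"
    by (rule comm_algebra_pscale)
  have fin: "\<exists>S. finite S \<and> pvars f \<subseteq> S \<and> pvars g \<subseteq> S \<and> pvars h \<subseteq> S" for f g h :: "'a mpoly"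
    by (intro exI[of _ "pvars f \<union> pvars g \<union> pvars h"]) auto
  note simps = poly_bracket_superset partial_add partial_pscale partial_mult scale_mult_left
    scale_mult_right scale_sum_right sum.distrib sum_distrib_left sum_distrib_right algebra_simps
  show ?thesis
  proof
    fix x y z :: "'a mpoly" and a :: complex
    obtain S where S: "finite S" "pvars x \<subseteq> S" "pvars (x + y) \<subseteq> S" "pvars y \<subseteq> S"
      using fin by metis
    obtain S' where S': "finite S'" "pvars x \<subseteq> S'" "pvars (x * y) \<subseteq> S'" "pvars y \<subseteq> S'"
      using fin by metis
    obtain U where U: "finite U" "pvars x \<subseteq> U" "pvars (pscale a x) \<subseteq> U"
      using fin by metis
    obtain T where T: "finite T" "pvars z \<subseteq> T"
      using finite_pvars by blast
    show "poly_bracket c (x + y) z = poly_bracket c x z + poly_bracket c y z"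
      using S T by (simp add: poly_bracket_superset[of S _ T] partial_add algebra_simps sum.distrib)
    show "poly_bracket c z (x + y) = poly_bracket c z x + poly_bracket c z y"
      using S T by (simp add: poly_bracket_superset[of T _ S] partial_add algebra_simps sum.distrib)
    show "poly_bracket c (pscale a x) z = pscale a (poly_bracket c x z)"
      using U T by (simp add: poly_bracket_superset[of U _ T] partial_pscale scale_mult_left scale_sum_right)
    show "poly_bracket c z (pscale a x) = pscale a (poly_bracket c z x)"
      using U T by (simp add: poly_bracket_superset[of T _ U] partial_pscale scale_mult_left
          scale_mult_right scale_sum_right)
    show "poly_bracket c (x * y) z = x * poly_bracket c y z + poly_bracket c x z * y"
      using S' T by (simp add: poly_bracket_superset[of S' _ T] partial_mult algebra_simps
          sum.distrib sum_distrib_left)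
    show "poly_bracket c z (x * y) = x * poly_bracket c z y + poly_bracket c z x * y"
      using S' T by (simp add: poly_bracket_superset[of T _ S'] partial_mult algebra_simps
          sum.distrib sum_distrib_left)
  qed
qed

lemma poly_bracket_Var: "poly_bracket c (Var u) (Var v) = c u v"
proof -
  have "pvars (Var w) = {w}" for w :: 'a by (simp add: pvars_def Var_def)
  then show ?thesis by (simp add: poly_bracket_def partial_Var)
qed

lemma (in biderivation) br_1_left [simp]: "br 1 x = 0"
  using br_mult_left[of 1 1 x] by simp

lemma (in biderivation) br_1_right [simp]: "br x 1 = 0"
  using br_mult_right[of x 1 1] by simp

lemma poly_bracket_unique:
  assumes b: "biderivation pscale b" and c: "\<And>u v. b (Var u) (Var v) = c u v"
  shows "b = poly_bracket c"
proof (intro ext)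
  fix f g
  interpret B: biderivation pscale b by (rule b)
  interpret P: biderivation pscale "poly_bracket c" by (rule biderivation_poly_bracket)
  show "b f g = poly_bracket c f g"
  proof (induction f rule: mpoly_induct)
    case (Var u)
    show ?case
      by (induction g rule: mpoly_induct)
         (simp_all add: c poly_bracket_Var B.br_add_right P.br_add_right B.br_scale_right
            P.br_scale_right B.br_mult_right P.br_mult_right)
  qed (simp_all add: B.br_add_left P.br_add_left B.br_scale_left
            P.br_scale_left B.br_mult_left P.br_mult_left)
qed


subsection \<open>The brackets on the algebra of the \<open>p\<^sub>i\<^sub>j(z)\<close>\<close>

lemma Y_bracket_pgen:
  assumes "z \<noteq> []" "w \<noteq> []"
  shows "Y_bracket (pgen i j z) (pgen k l w) = gen_bracket i j z k l w"
  using assms by (simp add: Y_bracket_def pgen_def poly_bracket_Var Word_inverse)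

lemma alg_hom_phi: "alg_hom pscale pscale (phi h)"
  unfolding phi_def by (rule comm_algebra.alg_hom_poly_eval[OF comm_algebra_pscale])

lemma phi_Var: "phi h (Var (Gen i j z)) =
    pscale (h powi (1 - int (length (letters z)))) (Var (Gen i j z))"
  by (simp add: phi_def comm_algebra.poly_eval_Var[OF comm_algebra_pscale])

lemma phi_pgen: "z \<noteq> [] \<Longrightarrow> phi h (pgen i j z) = pscale (h powi (1 - int (length z))) (pgen i j z)"
  by (simp add: pgen_def phi_Var Word_inverse)

lemma phi_phi_inverse:
  assumes "h \<noteq> 0"
  shows "phi h (phi (inverse h) f) = f"
proof (induction f rule: mpoly_induct)
  case (Var v)
  show ?case
  proof (cases v)
    case (Gen i j z)
    have "inverse h powi n * h powi n = 1" for n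
      using assms by (simp flip: power_int_mult_distrib)
    then show ?thesis
      by (intro poly_mapping_eqI)
         (simp add: Gen phi_Var alg_hom_simps[OF alg_hom_phi] flip: mult.assoc)
  qed
qed (simp_all add: alg_hom_simps[OF alg_hom_phi])

lemma bij_phi:
  assumes "h \<noteq> 0"
  shows "bij (phi h)"
  using phi_phi_inverse[OF assms] phi_phi_inverse[of "inverse h"] assms
  by (intro o_bij[of "phi (inverse h)"]) (auto simp: fun_eq_iff)


subsection \<open>The Lie algebra and the symmetric algebra\<close>

lemma bilinear_ext_superset:
  assumes "finite S" "Poly_Mapping.keys x \<subseteq> S" "finite T" "Poly_Mapping.keys y \<subseteq> T"
  shows "bilinear_ext \<beta> x y = (\<Sum>a\<in>S. \<Sum>b\<in>T.
           pscale (Poly_Mapping.lookup x a * Poly_Mapping.lookup y b) (\<beta> a b))"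
proof -
  have "bilinear_ext \<beta> x y = (\<Sum>a\<in>Poly_Mapping.keys x. \<Sum>b\<in>T.
           pscale (Poly_Mapping.lookup x a * Poly_Mapping.lookup y b) (\<beta> a b))"
    unfolding bilinear_ext_def using assms
    by (intro sum.cong refl sum.mono_neutral_left) (auto simp: in_keys_iff)
  also have "\<dots> = (\<Sum>a\<in>S. \<Sum>b\<in>T.
           pscale (Poly_Mapping.lookup x a * Poly_Mapping.lookup y b) (\<beta> a b))"
    using assms by (intro sum.mono_neutral_left) (auto simp: in_keys_iff)
  finally show ?thesis .
qed

lemma bilinear_ext_single:
  "bilinear_ext \<beta> (Poly_Mapping.single a c) (Poly_Mapping.single b d) = pscale (c * d) (\<beta> a b)"
  by (simp add: bilinear_ext_superset[of "{a}" _ "{b}"])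

lemma bilinear_ext_add_left:
  "bilinear_ext \<beta> (x + y) z = bilinear_ext \<beta> x z + bilinear_ext \<beta> y z"
proof -
  let ?S = "Poly_Mapping.keys x \<union> Poly_Mapping.keys y"
  have "Poly_Mapping.keys (x + y) \<subseteq> ?S" by (rule Poly_Mapping.keys_add)
  then show ?thesis
    by (simp add: bilinear_ext_superset[of ?S _ "Poly_Mapping.keys z"] lookup_add
        distrib_right pscale_add_left sum.distrib)
qed

lemma bilinear_ext_add_right:
  "bilinear_ext \<beta> z (x + y) = bilinear_ext \<beta> z x + bilinear_ext \<beta> z y"
proof -
  let ?S = "Poly_Mapping.keys x \<union> Poly_Mapping.keys y"
  have "Poly_Mapping.keys (x + y) \<subseteq> ?S" by (rule Poly_Mapping.keys_add)
  then show ?thesis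
    by (simp add: bilinear_ext_superset[of "Poly_Mapping.keys z" _ ?S] lookup_add
        distrib_left pscale_add_left sum.distrib)
qed

lemma bilinear_ext_scale:
  "bilinear_ext \<beta> (pscale c x) y = pscale c (bilinear_ext \<beta> x y)"
  "bilinear_ext \<beta> x (pscale c y) = pscale c (bilinear_ext \<beta> x y)"
proof -
  have "Poly_Mapping.keys (pscale c x) \<subseteq> Poly_Mapping.keys x"
       "Poly_Mapping.keys (pscale c y) \<subseteq> Poly_Mapping.keys y"
    by (auto simp: in_keys_iff)
  then show "bilinear_ext \<beta> (pscale c x) y = pscale c (bilinear_ext \<beta> x y)"
       "bilinear_ext \<beta> x (pscale c y) = pscale c (bilinear_ext \<beta> x y)"
    by (simp_all add: bilinear_ext_superset[of "Poly_Mapping.keys x" _ "Poly_Mapping.keys y"]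
        pscale_sum pscale_pscale mult_ac)
qed

lemma bilinear_ext_0 [simp]: "bilinear_ext \<beta> 0 y = 0" "bilinear_ext \<beta> x 0 = 0"
  by (simp_all add: bilinear_ext_def)

lemma bilinear_ext_sum:
  "bilinear_ext \<beta> (\<Sum>s\<in>S. f s) y = (\<Sum>s\<in>S. bilinear_ext \<beta> (f s) y)"
  "bilinear_ext \<beta> x (\<Sum>s\<in>S. h s) = (\<Sum>s\<in>S. bilinear_ext \<beta> x (h s))"
  by (induction S rule: infinite_finite_induct)
     (simp_all add: bilinear_ext_add_left bilinear_ext_add_right)

lemma lookup_unit_tensor:
  "Poly_Mapping.lookup (unit_tensor i j a) (i', j', z) =
     (if i' = i \<and> j' = j then Poly_Mapping.lookup a z else 0)"
  by (auto simp: unit_tensor_def lookup_sum lookup_single when_def in_keys_iff)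

lemma sum_if_const: "(\<Sum>x\<in>S. if P then f x else 0) = (if P then sum f S else 0)"
  by simp

lemma lookup_tensor:
  "Poly_Mapping.lookup (tensor A a) (i, j, z) = A $ i $ j * Poly_Mapping.lookup a z"
proof -
  have "A $ i' $ j' * Poly_Mapping.lookup (unit_tensor i' j' a) (i, j, z) =
      (if i' = i then if j' = j then A $ i' $ j' * Poly_Mapping.lookup a z else 0 else 0)" for i' j'
    by (auto simp: lookup_unit_tensor)
  then show ?thesis
    unfolding tensor_def lookup_sum lookup_pscale by (simp add: sum_if_const)
qed

lemma unit_tensor_add: "unit_tensor i j (a + b) = unit_tensor i j a + unit_tensor i j b"
  by (rule poly_mapping_eqI) (auto simp: lookup_unit_tensor lookup_add split: prod.splits elim!: prod.exhaust)

lemma unit_tensor_scale: "unit_tensor i j (pscale c a) = pscale c (unit_tensor i j a)"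
  by (rule poly_mapping_eqI) (auto simp: lookup_unit_tensor)

lemma unit_tensor_single:
  "unit_tensor i j (Poly_Mapping.single z c) = Poly_Mapping.single (i, j, z) c"
  by (cases "c = 0") (simp_all add: unit_tensor_def)

lemma g_mult_unit_tensor:
  "g_mult (unit_tensor i j a) (unit_tensor k l b) = (if j = k then unit_tensor i l (R_mult a b) else 0)"
proof (induction a rule: poly_mapping_additive_induct)
  case (single z c)
  show ?case
    by (induction b rule: poly_mapping_additive_induct)
       (simp_all add: g_mult_def R_mult_def unit_tensor_single bilinear_ext_single
          unit_tensor_scale unit_tensor_add bilinear_ext_add_right pscale_single
          pscale_add_right)
qed (simp_all add: g_mult_def R_mult_def unit_tensor_add bilinear_ext_add_left)

lemma g_mult_tensor: "g_mult (tensor A a) (tensor B b) = tensor (A ** B) (R_mult a b)"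
proof (rule poly_mapping_eqI, clarify)
  fix i l z
  let ?L = "Poly_Mapping.lookup (R_mult a b) z"
  have "g_mult (tensor A a) (tensor B b) =
      (\<Sum>i\<in>UNIV. \<Sum>j\<in>UNIV. pscale (A $ i $ j) (g_mult (unit_tensor i j a) (tensor B b)))"
    unfolding tensor_def[of A] g_mult_def bilinear_ext_sum(1) bilinear_ext_scale(1) ..
  moreover have "g_mult (unit_tensor i j a) (tensor B b) =
      (\<Sum>k\<in>UNIV. \<Sum>l\<in>UNIV. pscale (B $ k $ l) (g_mult (unit_tensor i j a) (unit_tensor k l b)))"
    for i j unfolding tensor_def g_mult_def bilinear_ext_sum(2) bilinear_ext_scale(2) ..
  ultimately have "Poly_Mapping.lookup (g_mult (tensor A a) (tensor B b)) (i, l, z) =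
      (\<Sum>i'\<in>UNIV. \<Sum>j\<in>UNIV. \<Sum>k\<in>UNIV. \<Sum>l'\<in>UNIV. A $ i' $ j * (B $ k $ l' *
        Poly_Mapping.lookup (g_mult (unit_tensor i' j a) (unit_tensor k l' b)) (i, l, z)))"
    by (simp add: lookup_sum sum_distrib_left)
  moreover have "A $ i' $ j * (B $ k $ l' *
        Poly_Mapping.lookup (g_mult (unit_tensor i' j a) (unit_tensor k l' b)) (i, l, z)) =
      (if i' = i then if k = j then if l' = l then A $ i' $ j * (B $ k $ l' * ?L) else 0 else 0 else 0)"
    for i' j k l' by (auto simp: g_mult_unit_tensor lookup_unit_tensor)
  ultimately have "Poly_Mapping.lookup (g_mult (tensor A a) (tensor B b)) (i, l, z) =
      (\<Sum>j\<in>UNIV. A $ i $ j * (B $ j $ l * ?L))"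
    by (simp add: sum_if_const)
  then show "Poly_Mapping.lookup (g_mult (tensor A a) (tensor B b)) (i, l, z) =
      Poly_Mapping.lookup (tensor (A ** B) (R_mult a b)) (i, l, z)"
    by (simp add: lookup_tensor matrix_matrix_mult_def sum_distrib_right mult.assoc)
qed

lemma sym_incl_superset:
  assumes "finite S" "Poly_Mapping.keys x \<subseteq> S"
  shows "sym_incl x = (\<Sum>b\<in>S. pscale (Poly_Mapping.lookup x b) (Var b))"
  unfolding sym_incl_def using assms
  by (intro sum.mono_neutral_left) (auto intro!: poly_mapping_eqI simp: in_keys_iff)

lemma linear_sym_incl: "Vector_Spaces.linear pscale pscale sym_incl"
  unfolding Vector_Spaces.linear_iff
proof (intro conjI allI vector_space_pscale)
  fix x y :: "'a \<Rightarrow>\<^sub>0 complex" and c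
  let ?S = "Poly_Mapping.keys x \<union> Poly_Mapping.keys y"
  have "Poly_Mapping.keys (x + y) \<subseteq> ?S" by (rule Poly_Mapping.keys_add)
  then show "sym_incl (x + y) = sym_incl x + sym_incl y"
    by (simp add: sym_incl_superset[of ?S] lookup_add sum.distrib
        pscale_add_left)
  have "Poly_Mapping.keys (pscale c x) \<subseteq> Poly_Mapping.keys x"
    by (auto simp: in_keys_iff)
  then show "sym_incl (pscale c x) = pscale c (sym_incl x)"
    by (simp add: sym_incl_superset[of "Poly_Mapping.keys x"]
        pscale_sum
        pscale_pscale)
qed

lemma sym_incl_add: "sym_incl (x + y) = sym_incl x + sym_incl y"
  and sym_incl_pscale: "sym_incl (pscale c x) = pscale c (sym_incl x)"
  by (simp_all add: linear_sym_incl[unfolded Vector_Spaces.linear_iff])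

lemma sym_incl_single: "sym_incl (Poly_Mapping.single b c) = pscale c (Var b)"
  by (simp add: sym_incl_superset[of "{b}"])

lemma sym_universal:
  assumes A: "comm_algebra sc" and f: "Vector_Spaces.linear pscale sc f"
  shows "\<exists>!F. alg_hom pscale sc F \<and> (\<forall>x. F (sym_incl x) = f x)"
proof (rule ex1I)
  interpret comm_algebra sc by (rule A)
  have f_add: "f (x + y) = f x + f y" and f_scale: "f (pscale c x) = sc c (f x)" for x y c
    by (simp_all add: f[unfolded Vector_Spaces.linear_iff])
  let ?F = "poly_eval sc (\<lambda>b. f (Poly_Mapping.single b 1))"
  have "?F (sym_incl x) = f x" for x
  proof (induction x rule: poly_mapping_additive_induct)
    case (single b c)
    have "f (Poly_Mapping.single b c) = f (pscale c (Poly_Mapping.single b 1))"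
      by (simp add: pscale_single)
    also have "\<dots> = sc c (f (Poly_Mapping.single b 1))"
      by (rule f_scale)
    finally show ?case by (simp add: sym_incl_single poly_eval_pscale poly_eval_Var)
  next
    case (add x y)
    then show ?case by (simp add: poly_eval_add sym_incl_add f_add)
  qed
  then show F: "alg_hom pscale sc ?F \<and> (\<forall>x. ?F (sym_incl x) = f x)"
    by (simp add: alg_hom_poly_eval)
  fix G assume G: "alg_hom pscale sc G \<and> (\<forall>x. G (sym_incl x) = f x)"
  have Var: "Var b = sym_incl (Poly_Mapping.single b 1)" for b
    by (rule poly_mapping_eqI) (simp add: sym_incl_single)
  show "G = ?F"
  proof
    fix g show "G g = ?F g"
    proof (rule alg_hom_mpoly_unique)
      show "G (Var b) = ?F (Var b)" for b
        using F G by (metis Var)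
    qed (use F G in blast)+
  qed
qed

lemma sym_bracket_sym_incl:
  assumes "\<And>x. Vector_Spaces.linear pscale pscale (lie x)"
    and "\<And>y. Vector_Spaces.linear pscale pscale (\<lambda>x. lie x y)"
  shows "sym_bracket lie (sym_incl x) (sym_incl y) = sym_incl (lie x y)"
proof -
  note l1 = assms(1)[unfolded Vector_Spaces.linear_iff, THEN conjunct2, THEN conjunct2]
  note l2 = assms(2)[unfolded Vector_Spaces.linear_iff, THEN conjunct2, THEN conjunct2]
  have add: "lie (a + b) c = lie a c + lie b c" "lie c (a + b) = lie c a + lie c b"
    and scale: "lie (pscale r a) c = pscale r (lie a c)" "lie c (pscale r a) = pscale r (lie c a)"
    for a b c r using l1 l2 by auto
  interpret P: biderivation pscale "sym_bracket lie"
    unfolding sym_bracket_def by (rule biderivation_poly_bracket)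
  have single': "Poly_Mapping.single a r = pscale r (Poly_Mapping.single a 1)" for a :: 'a and r
    by (simp add: pscale_single)
  show ?thesis
  proof (induction x rule: poly_mapping_additive_induct)
    case (single a r)
    show ?case
    proof (induction y rule: poly_mapping_additive_induct)
      case (single b s)
      have "sym_bracket lie (Var a) (Var b) =
          sym_incl (lie (Poly_Mapping.single a 1) (Poly_Mapping.single b 1))"
        by (simp add: sym_bracket_def poly_bracket_Var)
      moreover have "lie (Poly_Mapping.single a r) (Poly_Mapping.single b s) =
          pscale r (pscale s (lie (Poly_Mapping.single a 1) (Poly_Mapping.single b 1)))"
        by (subst single'[of a r], subst single'[of b s]) (simp only: scale pscale_pscale mult_ac)
      ultimately show ?case
        by (simp add: sym_incl_single P.br_scale_left P.br_scale_right sym_incl_pscale)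
    qed (simp add: sym_incl_add add P.br_add_right)
  qed (simp add: sym_incl_add add P.br_add_left)
qed

lemma Sg_bracket_sym_incl: "Sg_bracket (sym_incl x) (sym_incl y) = sym_incl (g_lie x y)"
  unfolding Sg_bracket_def
  by (rule sym_bracket_sym_incl; unfold Vector_Spaces.linear_iff; intro conjI allI vector_space_pscale)
     (simp_all add: g_lie_def g_mult_def bilinear_ext_add_left bilinear_ext_add_right
        bilinear_ext_scale algebra_simps pscale_diff_right)

end

theory Submission
  imports Defs
begin

text \<open>
  The substance of the theorem is the Jacobi identity for the bracket of the generators. The
  matrix indices only label the factors: the bracket of \<open>p\<^sub>i\<^sub>j(z)\<close> and \<open>p\<^sub>k\<^sub>l(w)\<close> is the image,
  under \<open>u \<otimes> v \<mapsto> p\<^sub>k\<^sub>j(u) p\<^sub>i\<^sub>l(v)\<close>, of the element \<open>{{z, w}}\<close> of the tensor square of the free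
  algebra on the letters that is the sum of
  \<open>w\<^sub><\<^sub>q z\<^sub>>\<^sub>r \<otimes> z\<^sub>\<le>\<^sub>r w\<^sub>>\<^sub>q - w\<^sub><\<^sub>q z\<^sub>\<ge>\<^sub>r \<otimes> z\<^sub><\<^sub>r w\<^sub>>\<^sub>q\<close>
  over the pairs of positions with \<open>z\<^sub>r = w\<^sub>q\<close>. This \<open>{{-, -}}\<close> is a double Poisson bracket
  in the sense of Van den Bergh: it is skew-symmetric up to exchanging the tensor factors, it is a
  derivation in each argument, and the cyclic sum of its iterates, the triple bracket, is again a
  derivation in each argument. Hence the triple bracket vanishes once
  it does so on letters (\<open>triple_bracket_eq_0\<close>). The Jacobiator of three generators is the
  difference of two triple brackets (\<open>Y_bracket_nested\<close>), so it is zero.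

  All words \<open>u\<close>, \<open>v\<close> in \<open>{{z, w}}\<close> satisfy \<open>|u| + |v| = |z| + |w| - 1\<close>. Therefore, after the
  rescaling by \<open>\<phi>\<^sub>h\<close>, a term in which \<open>u\<close> or \<open>v\<close> is empty, that is linear in the generators, is
  unchanged, and a quadratic term is multiplied by \<open>h\<close>. So the rescaled bracket is
  \<open>B\<^sub>0 + h B\<^sub>1\<close> with biderivations \<open>B\<^sub>0\<close>, \<open>B\<^sub>1\<close> independent of \<open>h\<close> (\<open>Y_bracket_h_eq\<close>): it tends to
  \<open>B\<^sub>0\<close>, and \<open>B\<^sub>0\<close> is Poisson because the identities that define a Poisson bracket survive limits.

  A linear term arises only when the last letter of one word meets the first letter of the
  other (\<open>double_bracket_degenerate\<close>), and then its value is the word obtained by merging these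
  two letters. This is the commutator in \<open>\<gg>\<close>, so identifying \<open>p\<^sub>i\<^sub>j(z)\<close> with
  \<open>E\<^sub>i\<^sub>j \<otimes> z\<close> turns \<open>B\<^sub>0\<close> into the bracket of the symmetric algebra.
\<close>


section \<open>Poisson brackets on polynomial algebras\<close>

text \<open>
  For a skew-symmetric biderivation the Jacobiator is a derivation in each argument, since the
  products of two brackets that come from the Leibniz rule cancel. It is also invariant under
  cyclic shifts, so it is enough to pass from variables to polynomials in the first argument,
  three times.
\<close>

lemma poisson_algebra_mpolyI:
  fixes b :: "'v mpoly \<Rightarrow> 'v mpoly \<Rightarrow> 'v mpoly"
  assumes b: "biderivation pscale b"
    and antisym: "\<And>u v. b (Var u) (Var v) = - b (Var v) (Var u)"
    and jacobi: "\<And>u v w. b (Var u) (b (Var v) (Var w)) + b (Var v) (b (Var w) (Var u))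
                   + b (Var w) (b (Var u) (Var v)) = 0"
  shows "poisson_algebra pscale b"
proof -
  interpret biderivation pscale b by (rule b)
  have anti_Var: "b (Var u) g = - b g (Var u)" for u g
    by (induction g rule: mpoly_induct)
       (simp_all add: antisym[of u] br_add_left br_add_right br_scale_left br_scale_right
          br_mult_left br_mult_right scale_minus_right algebra_simps)
  have anti: "b f g = - b g f" for f g
    by (induction f rule: mpoly_induct)
       (simp_all add: anti_Var br_add_left br_add_right br_scale_left br_scale_right
          br_mult_left br_mult_right scale_minus_right algebra_simps)
  define J where "J x y z = b x (b y z) + b y (b z x) + b z (b x y)" for x y z
  have cyc: "J x y z = J y z x" for x y z
    by (simp add: J_def add_ac)
  have b0: "b x 0 = 0" "b 0 x = 0" for x
    using br_scale_right[of x 0 0] br_scale_left[of 0 0 x] by simp_all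
  have b_minus: "b x (- y) = - b x y" for x y
    using br_add_right[of x "- y" y] by (simp add: b0 eq_neg_iff_add_eq_0)
  have b_diff: "b x (y - z) = b x y - b x z" for x y z
    using br_add_right[of x y "- z"] by (simp add: b_minus)
  have step: "J f y z = 0" if "\<And>u. J (Var u) y z = 0" for f y z
  proof (induction f rule: mpoly_induct)
    case one
    then show ?case by (simp add: J_def b0)
  next
    case (Var v)
    then show ?case by (rule that)
  next
    case (scale c f)
    have "J (pscale c f) y z = pscale c (J f y z)"
      by (simp add: J_def br_scale_left br_scale_right scale_right_distrib)
    with scale show ?case by simp
  next
    case (add f g)
    have "J (f + g) y z = J f y z + J g y z"
      by (simp add: J_def br_add_left br_add_right algebra_simps)
    with add show ?case by simp
  next
    case (mult f g)
    have "J (f * g) y z = f * J g y z + J f y z * g"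
      unfolding J_def
      by (simp add: br_mult_left br_mult_right br_add_right b_minus b_diff anti[of f y] anti[of g y]
          algebra_simps)
    with mult show ?case by simp
  qed
  have "J (Var u) (Var v) (Var w) = 0" for u v w
    using jacobi by (simp add: J_def)
  then have "J f (Var v) (Var w) = 0" for f v w by (rule step)
  then have "J (Var u) g (Var w) = 0" for g u w
    using cyc by metis
  then have "J f g (Var w) = 0" for f g w by (rule step)
  then have "J (Var u) g h = 0" for g h u
    using cyc by metis
  then have J: "J f g h = 0" for f g h by (rule step)
  \<comment> \<open>Skew-symmetry gives the alternating property because \<open>2\<close> is invertible in \<open>\<complex>\<close>.\<close>
  have "b x x = 0" for x
  proof (rule poly_mapping_eqI)
    fix m
    have "Poly_Mapping.lookup (b x x) m = - Poly_Mapping.lookup (b x x) m"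
      using arg_cong[OF anti[of x x], of "\<lambda>p. Poly_Mapping.lookup p m"] by simp
    then show "Poly_Mapping.lookup (b x x) m = Poly_Mapping.lookup 0 m" by simp
  qed
  then show ?thesis
    using J by unfold_locales (simp_all add: J_def)
qed

lemma biderivation_transport:
  assumes b: "biderivation s2 b"
    and s1: "comm_algebra s1"
    and f: "alg_hom s1 s2 f" and g: "alg_hom s2 s1 g" and gf: "\<And>x. g (f x) = x"
  shows "biderivation s1 (\<lambda>x y. g (b (f x) (f y)))"
proof -
  interpret A: comm_algebra s1 by (rule s1)
  interpret B: biderivation s2 b by (rule b)
  show ?thesis
    by unfold_locales
       (simp_all add: alg_hom_simps[OF f] alg_hom_simps[OF g] gf B.br_add_left B.br_add_right
          B.br_scale_left B.br_scale_right B.br_mult_left B.br_mult_right)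
qed

lemma alg_hom_0: "alg_hom s1 s2 f \<Longrightarrow> f 0 = 0"
  using alg_hom_simps(1)[of s1 s2 f 0 0] by simp

lemma poisson_algebra_transport:
  assumes b: "poisson_algebra s2 b"
    and s1: "comm_algebra s1"
    and f: "alg_hom s1 s2 f" and g: "alg_hom s2 s1 g"
    and gf: "\<And>x. g (f x) = x" and fg: "\<And>y. f (g y) = y"
  shows "poisson_algebra s1 (\<lambda>x y. g (b (f x) (f y)))"
proof -
  interpret B: poisson_algebra s2 b by (rule b)
  interpret T: biderivation s1 "\<lambda>x y. g (b (f x) (f y))"
    by (rule biderivation_transport[OF B.biderivation_axioms s1 f g gf])
  show ?thesis
    by unfold_locales
       (simp_all add: B.br_self B.jacobi fg alg_hom_0[OF g] flip: alg_hom_simps(1)[OF g])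
qed

lemma biderivation_pencil:
  assumes b0: "biderivation s b0" and b1: "biderivation s b1"
  shows "biderivation s (\<lambda>x y. b0 x y + s h (b1 x y))"
proof -
  interpret B0: biderivation s b0 by (rule b0)
  interpret B1: biderivation s b1 by (rule b1)
  show ?thesis
    by unfold_locales
       (simp_all add: B0.br_add_left B0.br_add_right B1.br_add_left B1.br_add_right
          B0.br_scale_left B0.br_scale_right B1.br_scale_left B1.br_scale_right
          B0.br_mult_left B0.br_mult_right B1.br_mult_left B1.br_mult_right
          B0.scale_right_distrib B0.scale_mult_left B0.scale_mult_right mult.commute algebra_simps)
qed

text \<open>
  A coefficient of the Jacobiator of \<open>b0 + h b1\<close> is a quadratic polynomial in \<open>h\<close> that is zero
  for all \<open>h \<noteq> 0\<close>; by continuity its constant term, the coefficient of the Jacobiator of \<open>b0\<close>,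
  is zero too.
\<close>

lemma poisson_algebra_limit:
  fixes b0 b1 :: "'v mpoly \<Rightarrow> 'v mpoly \<Rightarrow> 'v mpoly"
  assumes b0: "biderivation pscale b0" and b1: "biderivation pscale b1"
    and P: "\<And>h. h \<noteq> 0 \<Longrightarrow> poisson_algebra pscale (\<lambda>x y. b0 x y + pscale h (b1 x y))"
  shows "poisson_algebra pscale b0"
proof -
  interpret B0: biderivation pscale b0 by (rule b0)
  interpret B1: biderivation pscale b1 by (rule b1)
  have lim: "p = 0" if eq: "\<And>h. h \<noteq> 0 \<Longrightarrow> p + pscale h q + pscale (h * h) r = 0" for p q r :: "'v mpoly"
  proof (rule poly_mapping_eqI)
    fix m
    let ?l = "\<lambda>p :: 'v mpoly. Poly_Mapping.lookup p m"
    have "((\<lambda>h. ?l p + h * ?l q + h * h * ?l r) \<longlongrightarrow> ?l p + 0 * ?l q + 0 * 0 * ?l r) (at 0)"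
      by (intro tendsto_intros)
    moreover have "?l p + h * ?l q + h * h * ?l r = 0" if "h \<noteq> 0" for h
      using arg_cong[OF eq[OF that], of ?l] by (simp add: lookup_add)
    then have "\<forall>\<^sub>F h in at 0. ?l p + h * ?l q + h * h * ?l r = 0"
      by (simp add: eventually_at_filter)
    ultimately show "?l p = ?l 0"
      using tendsto_eventually LIM_unique by fastforce
  qed
  show ?thesis
  proof unfold_locales
    fix x y z
    show "b0 x x = 0"
      by (rule lim[of _ "b1 x x" 0]) (simp add: poisson_algebra.br_self[OF P])
    show "b0 x (b0 y z) + b0 y (b0 z x) + b0 z (b0 x y) = 0"
    proof (rule lim)
      fix h :: complex assume h: "h \<noteq> 0"
      show "b0 x (b0 y z) + b0 y (b0 z x) + b0 z (b0 x y)
        + pscale h (b0 x (b1 y z) + b0 y (b1 z x) + b0 z (b1 x y)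
            + b1 x (b0 y z) + b1 y (b0 z x) + b1 z (b0 x y))
        + pscale (h * h) (b1 x (b1 y z) + b1 y (b1 z x) + b1 z (b1 x y)) = 0"
        using poisson_algebra.jacobi[OF P[OF h], of x y z]
        by (simp add: B0.br_add_right B1.br_add_right B0.br_scale_right B1.br_scale_right
            pscale_add_right pscale_pscale algebra_simps)
    qed
  qed
qed


section \<open>The double bracket of words\<close>

text \<open>
  Instead of elements of the tensor square of the free algebra, the double bracket is described
  by its image under an arbitrary function \<open>F\<close> of the two tensor factors, extended linearly.
  Since \<open>F\<close> is arbitrary, nothing is lost, and multiplying a tensor factor by a word becomes
  a change of \<open>F\<close>.
\<close>

definition double_bracket ::
  "'l list \<Rightarrow> 'l list \<Rightarrow> ('l list \<Rightarrow> 'l list \<Rightarrow> 'a::ab_group_add) \<Rightarrow> 'a" where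
  "double_bracket z w F =
     (\<Sum>r<length z. \<Sum>q<length w.
        if z ! r = w ! q
        then F (take q w @ drop (Suc r) z) (take (Suc r) z @ drop (Suc q) w)
           - F (take q w @ drop r z) (take r z @ drop (Suc q) w)
        else 0)"

lemma double_bracket_Nil [simp]:
  "double_bracket [] w F = 0" "double_bracket z [] F = 0"
  by (simp_all add: double_bracket_def)

lemma double_bracket_letters:
  "double_bracket [a] [b] F = (if a = b then F [] [a] - F [a] [] else 0)"
  by (simp add: double_bracket_def)

text \<open>
  Every term of the double bracket has one letter less than its two arguments together; this
  homogeneity is what fixes the power of \<open>h\<close> in the rescaled bracket.
\<close>

lemma double_bracket_cong:
  assumes "\<And>u v. length u + length v + 1 = length z + length w \<Longrightarrow> F u v = G u v"
  shows "double_bracket z w F = double_bracket z w G"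
  unfolding double_bracket_def
  by (intro sum.cong refl if_cong arg_cong2[where f = "(-)"] assms) auto

text \<open>
  A factor \<open>w\<^sub><\<^sub>q z\<^sub>>\<^sub>r\<close> is empty only if \<open>q\<close> is the first position of \<open>w\<close> and \<open>r\<close> the last one of
  \<open>z\<close>, and \<open>z\<^sub><\<^sub>r w\<^sub>>\<^sub>q\<close> is empty only in the opposite situation, while the other two factors
  contain the matched letter. So at most one positive and one negative term remain.
\<close>

lemma double_bracket_degenerate:
  fixes F :: "'l list \<Rightarrow> 'l list \<Rightarrow> 'a::ab_group_add"
  assumes "z \<noteq> []" "w \<noteq> []"
  shows "double_bracket z w (\<lambda>u v. if u = [] \<or> v = [] then F u v else 0) =
    (if last z = hd w then F [] (z @ tl w) else 0) - (if last w = hd z then F (w @ tl z) [] else 0)"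
proof -
  let ?f = "if last z = hd w then F [] (z @ tl w) else 0"
  let ?g = "if last w = hd z then F (w @ tl z) [] else 0"
  let ?G = "\<lambda>u v. if u = [] \<or> v = [] then F u v else 0"
  have glue: "butlast w @ z = w @ tl z" if "last w = hd z"
  proof -
    have "butlast w @ z = butlast w @ hd z # tl z"
      using assms by simp
    also have "\<dots> = (butlast w @ [last w]) @ tl z"
      by (simp add: that)
    also have "\<dots> = w @ tl z"
      using assms by (simp only: append_butlast_last_id not_False_eq_True)
    finally show ?thesis .
  qed
  have summand: "(if z ! r = w ! q
        then ?G (take q w @ drop (Suc r) z) (take (Suc r) z @ drop (Suc q) w)
           - ?G (take q w @ drop r z) (take r z @ drop (Suc q) w)
        else 0) =
      (if r = length z - 1 then if q = 0 then ?f else 0 else 0)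
      - (if r = 0 then if q = length w - 1 then ?g else 0 else 0)" (is "?t = ?a - ?b")
    if "r < length z" "q < length w" for r q
  proof -
    have a: "(if z ! r = w ! q then ?G (take q w @ drop (Suc r) z) (take (Suc r) z @ drop (Suc q) w) else 0) = ?a"
    proof (cases "r = length z - 1 \<and> q = 0")
      case True
      then have "Suc r = length z" "z ! r = last z" "w ! q = hd w" "drop (Suc q) w = tl w"
        using assms by (simp_all add: last_conv_nth hd_conv_nth drop_Suc)
      with True show ?thesis by simp
    next
      case False
      then have "take q w @ drop (Suc r) z \<noteq> []" "take (Suc r) z @ drop (Suc q) w \<noteq> []"
        using that assms by auto
      with False show ?thesis by (simp only: if_False if_cancel) auto
    qed
    have b: "(if z ! r = w ! q then ?G (take q w @ drop r z) (take r z @ drop (Suc q) w) else 0) = ?b"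
    proof (cases "r = 0 \<and> q = length w - 1")
      case True
      then have "Suc q = length w" "z ! r = hd z" "w ! q = last w" "take q w = butlast w"
        using assms by (simp_all add: last_conv_nth hd_conv_nth butlast_conv_take)
      with True assms show ?thesis by (auto simp: glue)
    next
      case False
      then have "take q w @ drop r z \<noteq> []" "take r z @ drop (Suc q) w \<noteq> []"
        using that assms by auto
      with False show ?thesis by (simp only: if_False if_cancel) auto
    qed
    have "(if P then A - B else 0) = (if P then A else 0) - (if P then B else 0)" for P and A B :: 'a
      by simp
    then show ?thesis by (simp only: a b)
  qed
  have "double_bracket z w ?G = (\<Sum>r<length z. \<Sum>q<length w.
      (if r = length z - 1 then if q = 0 then ?f else 0 else 0)
      - (if r = 0 then if q = length w - 1 then ?g else 0 else 0))"
    unfolding double_bracket_def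
  proof (intro sum.cong refl, goal_cases)
    case (1 r q)
    then show ?case by (intro summand) simp_all
  qed
  also have "\<dots> = (\<Sum>r<length z. if r = length z - 1 then \<Sum>q<length w. if q = 0 then ?f else 0 else 0)
      - (\<Sum>r<length z. if r = 0 then \<Sum>q<length w. if q = length w - 1 then ?g else 0 else 0)"
    by (simp only: sum_subtractf sum_if_const)
  also have "\<dots> = ?f - ?g"
    using assms by (simp only: sum.delta finite_lessThan lessThan_iff) simp
  finally show ?thesis .
qed

lemma double_bracket_additive:
  assumes "Modules.additive f"
  shows "f (double_bracket z w F) = double_bracket z w (\<lambda>u v. f (F u v))"
  unfolding double_bracket_def Modules.additive.sum[OF assms]
  by (intro sum.cong refl) (simp add: Modules.additive.diff[OF assms] Modules.additive.zero[OF assms])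

lemma double_bracket_add:
  "double_bracket z w (\<lambda>u v. F u v + G u v) = double_bracket z w F + double_bracket z w G"
  unfolding double_bracket_def sum.distrib[symmetric]
  by (intro sum.cong refl) auto

lemma double_bracket_diff:
  "double_bracket z w (\<lambda>u v. F u v - G u v) = double_bracket z w F - double_bracket z w G"
  unfolding double_bracket_def sum_subtractf[symmetric]
  by (intro sum.cong refl) auto

lemma double_bracket_0: "double_bracket z w (\<lambda>u v. 0) = 0"
  by (simp add: double_bracket_def cong: if_cong)

lemma double_bracket_sum:
  "double_bracket z w (\<lambda>u v. \<Sum>s\<in>S. F s u v) = (\<Sum>s\<in>S. double_bracket z w (F s))"
  by (induction S rule: infinite_finite_induct)
     (simp_all add: double_bracket_0 double_bracket_add)

lemma double_bracket_commute:
  fixes F :: "'l list \<Rightarrow> 'l list \<Rightarrow> 'l list \<Rightarrow> 'l list \<Rightarrow> 'a::ab_group_add"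
  shows "double_bracket x y (\<lambda>s t. double_bracket z w (F s t)) =
   double_bracket z w (\<lambda>u v. double_bracket x y (\<lambda>s t. F s t u v))"
proof -
  have if_out: "double_bracket x y (\<lambda>s t. if P then G s t else 0) =
      (if P then double_bracket x y G else 0)" for P and G :: "'l list \<Rightarrow> 'l list \<Rightarrow> 'a"
    by (simp add: double_bracket_0)
  show ?thesis
    unfolding double_bracket_def[of z w]
    by (simp only: double_bracket_sum if_out double_bracket_diff)
qed

text \<open>
  The four factors split both words at the matched letter, which the first term leaves in the
  second factor and the second term in the first one. Exchanging the words and the factors
  exchanges these two cases; whether the letter is read from \<open>z\<close> or from \<open>w\<close> is immaterial.
\<close>

lemma double_bracket_antisym:
  fixes z w :: "'l list"
  shows "double_bracket z w F = - double_bracket w z (\<lambda>u v. F v u)"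
proof -
  have shift: "take (Suc q) v @ drop (Suc r) u = take q v @ drop r u"
    if "r < length u" "q < length v" "u ! r = v ! q" for r q and u v :: "'l list"
    using that by (simp add: take_Suc_conv_app_nth flip: Cons_nth_drop_Suc)
  have "- double_bracket w z (\<lambda>u v. F v u) = (\<Sum>r<length z. \<Sum>q<length w.
      - (if w ! q = z ! r
        then F (take (Suc q) w @ drop (Suc r) z) (take r z @ drop (Suc q) w)
           - F (take q w @ drop (Suc r) z) (take r z @ drop q w)
        else 0))"
    unfolding double_bracket_def by (subst sum.swap) (simp only: sum_negf)
  also have "\<dots> = double_bracket z w F"
    unfolding double_bracket_def
    by (intro sum.cong refl) (auto simp: shift)
  finally show ?thesis by simp
qed

lemma sum_lessThan_add:
  fixes f :: "nat \<Rightarrow> 'a::comm_monoid_add"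
  shows "(\<Sum>k<m + n. f k) = (\<Sum>k<m. f k) + (\<Sum>k<n. f (m + k))"
  by (induction n) (simp_all add: add_ac)

text \<open>
  The Leibniz rules: the matched letter lies in one of the two parts of the product, and the
  other part is attached to the right of the second factor or to the left of the first one
  (the outer bimodule structure). In the first argument it is attached on the inner side.
\<close>

lemma double_bracket_append_right:
  "double_bracket z (w1 @ w2) F =
   double_bracket z w1 (\<lambda>u v. F u (v @ w2)) + double_bracket z w2 (\<lambda>u v. F (w1 @ u) v)"
  unfolding double_bracket_def length_append sum_lessThan_add sum.distrib
  by (intro arg_cong2[where f = "(+)"] sum.cong refl) (simp_all add: nth_append)

lemma double_bracket_append_left:
  "double_bracket (z1 @ z2) w F =
   double_bracket z1 w (\<lambda>u v. F (u @ z2) v) + double_bracket z2 w (\<lambda>u v. F u (z1 @ v))"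
  by (simp add: double_bracket_antisym[of _ w] double_bracket_append_right)

text \<open>
  In Van den Bergh's notation this is \<open>{{x, {{y, z}}}}\<^sub>L\<close>: the bracket with \<open>x\<close> is applied to the
  first tensor factor of \<open>{{y, z}}\<close>.
\<close>

definition left_triple ::
  "'l list \<Rightarrow> 'l list \<Rightarrow> 'l list \<Rightarrow> ('l list \<Rightarrow> 'l list \<Rightarrow> 'l list \<Rightarrow> 'a::ab_group_add) \<Rightarrow> 'a" where
  "left_triple x y z F = double_bracket y z (\<lambda>u v. double_bracket x u (\<lambda>s t. F s t v))"

definition triple_bracket ::
  "'l list \<Rightarrow> 'l list \<Rightarrow> 'l list \<Rightarrow> ('l list \<Rightarrow> 'l list \<Rightarrow> 'l list \<Rightarrow> 'a::ab_group_add) \<Rightarrow> 'a" where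
  "triple_bracket x y z F =
     left_triple x y z F + left_triple y z x (\<lambda>a b c. F c a b) + left_triple z x y (\<lambda>a b c. F b c a)"

lemma triple_bracket_rotate:
  "triple_bracket x y z F = triple_bracket y z x (\<lambda>a b c. F c a b)"
  by (simp add: triple_bracket_def add_ac)

text \<open>
  Each of the first two summands of the triple bracket violates the Leibniz rule by a term in
  which \<open>x\<close> is matched with \<open>z1\<close> and \<open>y\<close> with \<open>z2\<close>. These two terms differ only in the order of
  \<open>x\<close> and \<open>z1\<close>, so they cancel by skew-symmetry.
\<close>

lemma triple_bracket_append:
  "triple_bracket x y (z1 @ z2) F =
   triple_bracket x y z1 (\<lambda>a b c. F a b (c @ z2)) + triple_bracket x y z2 (\<lambda>a b c. F (z1 @ a) b c)"
proof -
  let ?cross = "double_bracket y z2 (\<lambda>u v. double_bracket x z1 (\<lambda>s t. F s (t @ u) v))"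
  have 1: "left_triple x y (z1 @ z2) F =
      left_triple x y z1 (\<lambda>a b c. F a b (c @ z2)) + left_triple x y z2 (\<lambda>a b c. F (z1 @ a) b c)
      + ?cross"
    by (simp add: left_triple_def double_bracket_append_right double_bracket_add add_ac)
  have "double_bracket z1 x (\<lambda>u v. double_bracket y z2 (\<lambda>s t. F v (u @ s) t)) = - ?cross"
    by (subst double_bracket_antisym) (simp add: double_bracket_commute[of x z1])
  then have 2: "left_triple y (z1 @ z2) x (\<lambda>a b c. F c a b) =
      left_triple y z1 x (\<lambda>a b c. F c a (b @ z2)) + left_triple y z2 x (\<lambda>a b c. F (z1 @ c) a b)
      - ?cross"
    by (simp add: left_triple_def double_bracket_append_left double_bracket_append_right
        double_bracket_add)
  have 3: "left_triple (z1 @ z2) x y (\<lambda>a b c. F b c a) =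
      left_triple z1 x y (\<lambda>a b c. F b c (a @ z2)) + left_triple z2 x y (\<lambda>a b c. F (z1 @ b) c a)"
    by (simp add: left_triple_def double_bracket_append_left double_bracket_add)
  show ?thesis
    by (simp add: triple_bracket_def 1 2 3)
qed

text \<open>
  By the Leibniz rule in the last argument, and by cyclic symmetry in the others, it is enough
  to check three letters. On a single letter \<open>a\<close> the double bracket is \<open>1 \<otimes> a - a \<otimes> 1\<close>, and the
  cyclic sum telescopes.
\<close>

lemma triple_bracket_eq_0:
  fixes x y z :: "'l list" and F :: "'l list \<Rightarrow> 'l list \<Rightarrow> 'l list \<Rightarrow> 'a::ab_group_add"
  shows "triple_bracket x y z F = 0"
proof -
  have step: "triple_bracket x y z F = 0"
    if "\<And>a (F :: 'l list \<Rightarrow> 'l list \<Rightarrow> 'l list \<Rightarrow> 'a). triple_bracket x y [a] F = 0" for x y z :: "'l list" and F :: "_ \<Rightarrow> _ \<Rightarrow> _ \<Rightarrow> 'a"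
  proof (induction z arbitrary: F)
    case Nil
    show ?case by (simp add: triple_bracket_def left_triple_def double_bracket_0)
  next
    case (Cons a z)
    then show ?case
      using triple_bracket_append[of x y "[a]" z F] by (simp add: that)
  qed
  have "triple_bracket [a] [b] [c] F = 0" for a b c :: 'l and F :: "_ \<Rightarrow> _ \<Rightarrow> _ \<Rightarrow> 'a"
    by (simp add: triple_bracket_def left_triple_def double_bracket_letters)
  then have "triple_bracket [a] [b] z F = 0" for a b :: 'l and z and F :: "_ \<Rightarrow> _ \<Rightarrow> _ \<Rightarrow> 'a"
    by (rule step)
  then have "triple_bracket z [a] [b] F = 0" for a b :: 'l and z and F :: "_ \<Rightarrow> _ \<Rightarrow> _ \<Rightarrow> 'a"
    using triple_bracket_rotate by metis
  then have "triple_bracket z [a] y F = 0" for a :: 'l and y z and F :: "_ \<Rightarrow> _ \<Rightarrow> _ \<Rightarrow> 'a"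
    by (rule step)
  then have "triple_bracket y z [a] F = 0" for a :: 'l and y z and F :: "_ \<Rightarrow> _ \<Rightarrow> _ \<Rightarrow> 'a"
    using triple_bracket_rotate by metis
  then show ?thesis by (rule step)
qed


section \<open>The bracket of the generators is a Poisson bracket\<close>

lemma gen_bracket_eq_double_bracket:
  "gen_bracket i j z k l w = double_bracket z w (\<lambda>u v. pgen k j u * pgen i l v)"
  unfolding gen_bracket_def double_bracket_def by (simp add: sum.atLeast1_atMost_eq cong: if_cong)

lemma biderivation_Y_bracket: "biderivation pscale Y_bracket"
  unfolding Y_bracket_def by (rule biderivation_poly_bracket)

text \<open>
  This form also covers empty words, for which both sides vanish: the constant \<open>p\<^sub>i\<^sub>j(\<emptyset>)\<close> is
  annihilated by the bracket. Hence it can be iterated with no case distinctions on the words that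
  occur inside.
\<close>

lemma Y_bracket_pgen_double_bracket:
  "Y_bracket (pgen i j z) (pgen k l w) = double_bracket z w (\<lambda>u v. pgen k j u * pgen i l v)"
proof -
  interpret biderivation pscale Y_bracket by (rule biderivation_Y_bracket)
  have "Y_bracket 0 x = 0" "Y_bracket x 0 = 0" for x :: "('a, 'b) Y"
    using br_scale_left[of 0 0 x] br_scale_right[of x 0 0] by simp_all
  then show ?thesis
    by (cases "z = []"; cases "w = []")
       (simp_all add: Y_bracket_pgen gen_bracket_eq_double_bracket, simp_all add: pgen_def)
qed

lemma Var_Gen_eq_pgen: "Var (Gen i j z) = pgen i j (letters z)"
  using letters[of z] by (simp add: pgen_def letters_inverse)

text \<open>
  The inner bracket is a sum of products \<open>p\<^sub>s\<^sub>l(u) p\<^sub>k\<^sub>t(v)\<close>. Bracketing with the first factor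
  gives \<open>{{x, {{y, z}}}}\<^sub>L\<close>; bracketing with the second factor gives the same expression with
  \<open>y\<close> and \<open>z\<close> exchanged, up to the sign from skew-symmetry. In the cyclic sum over the three
  generators each kind of term adds up to one triple bracket.
\<close>

lemma Y_bracket_nested:
  "Y_bracket (pgen i j x) (Y_bracket (pgen k l y) (pgen s t z)) =
     left_triple x y z (\<lambda>a b c. pgen s j a * pgen i l b * pgen k t c)
   - left_triple x z y (\<lambda>a b c. pgen k j a * pgen i t b * pgen s l c)"
proof -
  interpret biderivation pscale Y_bracket by (rule biderivation_Y_bracket)
  have add: "Modules.additive (Y_bracket f)" for f :: "('a, 'b) Y"
    by unfold_locales (rule br_add_right)
  have mult: "Modules.additive ((*) f)" "Modules.additive (\<lambda>g. g * f)" for f :: "('a, 'b) Y"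
    by unfold_locales (simp_all add: algebra_simps)
  have "Y_bracket (pgen i j x) (Y_bracket (pgen k l y) (pgen s t z)) =
      double_bracket y z (\<lambda>u v. pgen s l u * Y_bracket (pgen i j x) (pgen k t v))
    + double_bracket y z (\<lambda>u v. Y_bracket (pgen i j x) (pgen s l u) * pgen k t v)"
    by (simp add: Y_bracket_pgen_double_bracket[of k l] double_bracket_additive[OF add]
        br_mult_right double_bracket_add)
  also have "double_bracket y z (\<lambda>u v. Y_bracket (pgen i j x) (pgen s l u) * pgen k t v) =
      left_triple x y z (\<lambda>a b c. pgen s j a * pgen i l b * pgen k t c)"
    by (simp add: Y_bracket_pgen_double_bracket left_triple_def double_bracket_additive[OF mult(2)])
  also have "double_bracket y z (\<lambda>u v. pgen s l u * Y_bracket (pgen i j x) (pgen k t v)) =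
      - left_triple x z y (\<lambda>a b c. pgen k j a * pgen i t b * pgen s l c)"
    by (subst double_bracket_antisym)
       (simp add: Y_bracket_pgen_double_bracket left_triple_def double_bracket_additive[OF mult(1)]
          mult_ac)
  finally show ?thesis by simp
qed

lemma poisson_algebra_Y_bracket: "poisson_algebra pscale Y_bracket"
proof (rule poisson_algebra_mpolyI[OF biderivation_Y_bracket])
  fix u v w :: "('a, 'b) generator"
  obtain i j x where u: "Var u = pgen i j x" by (metis Var_Gen_eq_pgen generator.exhaust)
  obtain k l y where v: "Var v = pgen k l y" by (metis Var_Gen_eq_pgen generator.exhaust)
  obtain s t z where w: "Var w = pgen s t z" by (metis Var_Gen_eq_pgen generator.exhaust)
  show "Y_bracket (Var u) (Var v) = - Y_bracket (Var v) (Var u)"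
    unfolding u v Y_bracket_pgen_double_bracket
    by (subst double_bracket_antisym) (simp add: mult.commute)
  have "triple_bracket x y z (\<lambda>a b c. pgen s j a * pgen i l b * pgen k t c)
      - triple_bracket x z y (\<lambda>a b c. pgen k j a * pgen i t b * pgen s l c) = 0"
    by (simp add: triple_bracket_eq_0)
  then show "Y_bracket (Var u) (Y_bracket (Var v) (Var w)) + Y_bracket (Var v) (Y_bracket (Var w) (Var u))
      + Y_bracket (Var w) (Y_bracket (Var u) (Var v)) = 0"
    unfolding u v w Y_bracket_nested triple_bracket_def
    by (simp add: mult_ac algebra_simps)
qed


section \<open>The rescaled brackets\<close>

lemma inv_phi:
  assumes "h \<noteq> 0"
  shows "inv (phi h) = phi (inverse h)"
proof
  fix x
  have "inv (phi h) (phi h (phi (inverse h) x)) = phi (inverse h) x"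
    by (rule inv_f_f) (rule bij_is_inj[OF bij_phi[OF assms]])
  then show "inv (phi h) x = phi (inverse h) x"
    by (simp add: phi_phi_inverse assms)
qed

lemma phi_1: "phi 1 f = f"
proof (induction f rule: mpoly_induct)
  case (Var v)
  show ?case by (cases v) (simp add: phi_Var pscale_conv_mult)
qed (simp_all add: alg_hom_simps[OF alg_hom_phi])

lemma poisson_algebra_Y_bracket_h:
  assumes "h \<noteq> 0"
  shows "poisson_algebra pscale (Y_bracket_h h)"
proof -
  have "poisson_algebra pscale (\<lambda>x y. phi h (Y_bracket (phi (inverse h) x) (phi (inverse h) y)))"
    by (rule poisson_algebra_transport[OF poisson_algebra_Y_bracket comm_algebra_pscale alg_hom_phi alg_hom_phi])
       (use phi_phi_inverse[of h] phi_phi_inverse[of "inverse h"] assms in auto)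
  then show ?thesis
    by (simp add: Y_bracket_h_def[abs_def] inv_phi[OF assms])
qed

text \<open>
  The terms with an empty factor are those that are linear in the generators. The other terms are
  quadratic and carry the factor \<open>h\<close> in the rescaled bracket.
\<close>

definition bracket_limit :: "('d, 'l) Y \<Rightarrow> ('d, 'l) Y \<Rightarrow> ('d, 'l) Y" where
  "bracket_limit = poly_bracket (\<lambda>u v. case u of Gen i j z \<Rightarrow> case v of Gen k l w \<Rightarrow>
     double_bracket (letters z) (letters w)
       (\<lambda>u v. if u = [] \<or> v = [] then pgen k j u * pgen i l v else 0))"

definition bracket_correction :: "('d, 'l) Y \<Rightarrow> ('d, 'l) Y \<Rightarrow> ('d, 'l) Y" where
  "bracket_correction = poly_bracket (\<lambda>u v. case u of Gen i j z \<Rightarrow> case v of Gen k l w \<Rightarrow>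
     double_bracket (letters z) (letters w)
       (\<lambda>u v. if u = [] \<or> v = [] then 0 else pgen k j u * pgen i l v))"

lemma biderivation_bracket_limit: "biderivation pscale bracket_limit"
  and biderivation_bracket_correction: "biderivation pscale bracket_correction"
  unfolding bracket_limit_def bracket_correction_def by (rule biderivation_poly_bracket)+

text \<open>
  The count of powers of \<open>h\<close>, with \<open>m\<close> and \<open>n\<close> the lengths of the two bracketed words. The inverse
  of \<open>\<phi>\<^sub>h\<close> contributes \<open>m + n - 2\<close> to the exponent, and \<open>\<phi>\<^sub>h\<close> contributes \<open>1 - |u|\<close> for
  each nonempty word \<open>u\<close>.
\<close>

lemma phi_pgen_mult_pgen:
  fixes u v :: "'l list" and i j k l :: 'd
  assumes h: "h \<noteq> 0" and len: "length u + length v + 1 = m + n" and mn: "m + n \<ge> 2"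
  shows "pscale (inverse h powi (1 - int m)) (pscale (inverse h powi (1 - int n))
      (phi h (pgen k j u * pgen i l v))) =
    (if u = [] \<or> v = [] then pgen k j u * pgen i l v else 0)
    + pscale h (if u = [] \<or> v = [] then 0 else pgen k j u * pgen i l v)"
proof -
  \<comment> \<open>The constant \<open>p\<^sub>a\<^sub>b(\<emptyset>)\<close> is fixed by \<open>\<phi>\<^sub>h\<close>, although \<open>1 - |\<emptyset>| = 1\<close>.\<close>
  define e where "e u = (if u = [] then 0 else 1 - int (length u))" for u :: "'l list"
  have phi_e: "phi h (pgen a b u) = pscale (h powi e u) (pgen a b u)" for a b :: 'd and u :: "'l list"
  proof (cases "u = []")
    case True
    have "phi h (1 :: ('d, 'l) Y) = 1" "phi h (0 :: ('d, 'l) Y) = 0"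
      by (rule alg_hom_simps(3)[OF alg_hom_phi] alg_hom_0[OF alg_hom_phi])+
    then show ?thesis using True by (simp add: e_def pgen_def pscale_conv_mult)
  qed (simp add: e_def phi_pgen)
  have scale: "pscale a f * pscale b g = pscale (a * b) (f * g)" for a b and f g :: "('d, 'l) Y"
    by (simp add: comm_algebra.scale_mult_left[OF comm_algebra_pscale]
        comm_algebra.scale_mult_right[OF comm_algebra_pscale] pscale_pscale mult.commute)
  have inv: "inverse h powi (1 - k) = h powi (k - 1)" for k
    using power_int_minus[of h "1 - k"] by (simp add: power_int_inverse)
  have powi_add: "h powi (a + b) = h powi a * h powi b" for a b
    using h by (simp add: power_int_add)
  have "inverse h powi (1 - int m) * inverse h powi (1 - int n) * (h powi e u * h powi e v) =
      h powi (int m - 1 + (int n - 1) + (e u + e v))"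
    by (simp only: inv powi_add mult.assoc)
  also have "int m - 1 + (int n - 1) + (e u + e v) = (if u = [] \<or> v = [] then 0 else 1)"
    using len mn by (auto simp: e_def)
  finally have exponent: "inverse h powi (1 - int m) * (inverse h powi (1 - int n) * (h powi e u * h powi e v)) =
      (if u = [] \<or> v = [] then 1 else h)"
    by (simp add: mult.assoc)
  show ?thesis
    unfolding alg_hom_simps(4)[OF alg_hom_phi] phi_e scale pscale_pscale exponent
    by (simp add: pscale_conv_mult)
qed

lemma Y_bracket_h_eq:
  fixes x y :: "('d, 'l) Y"
  assumes h: "h \<noteq> 0"
  shows "Y_bracket_h h x y = bracket_limit x y + pscale h (bracket_correction x y)"
proof -
  let ?c = "\<lambda>u v :: ('d, 'l) generator. bracket_limit (Var u) (Var v) + pscale h (bracket_correction (Var u) (Var v))"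
  interpret Y: biderivation pscale Y_bracket by (rule biderivation_Y_bracket)
  have lim: "(\<lambda>x y :: ('d, 'l) Y. bracket_limit x y + pscale h (bracket_correction x y)) = poly_bracket ?c"
    by (intro poly_bracket_unique biderivation_pencil biderivation_bracket_limit
        biderivation_bracket_correction refl)
  have gens: "Y_bracket_h h (Var u) (Var v) = ?c u v" for u v :: "('d, 'l) generator"
  proof -
    obtain i j z where u: "u = Gen i j z" by (cases u)
    obtain k l w where v: "v = Gen k l w" by (cases v)
    let ?a = "inverse h powi (1 - int (length (letters z)))"
    let ?b = "inverse h powi (1 - int (length (letters w)))"
    have add: "Modules.additive (\<lambda>f. pscale ?a (pscale ?b (phi h f)))"
      by unfold_locales (simp add: alg_hom_simps[OF alg_hom_phi] pscale_add_right)
    have len: "length (letters z) + length (letters w) \<ge> 2"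
      using letters[of z] letters[of w] by (simp add: Suc_le_eq flip: length_greater_0_conv)
    have "Y_bracket_h h (Var u) (Var v) =
        pscale ?a (pscale ?b (phi h (Y_bracket (Var u) (Var v))))"
      by (simp add: Y_bracket_h_def inv_phi[OF h] u v phi_Var Y.br_scale_left Y.br_scale_right
          alg_hom_simps[OF alg_hom_phi])
    also have "\<dots> = double_bracket (letters z) (letters w)
        (\<lambda>s t. pscale ?a (pscale ?b (phi h (pgen k j s * pgen i l t))))"
      by (simp only: u v Var_Gen_eq_pgen Y_bracket_pgen_double_bracket double_bracket_additive[OF add])
    also have "\<dots> = double_bracket (letters z) (letters w)
        (\<lambda>s t. (if s = [] \<or> t = [] then pgen k j s * pgen i l t else 0)
          + pscale h (if s = [] \<or> t = [] then 0 else pgen k j s * pgen i l t))"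
      by (intro double_bracket_cong phi_pgen_mult_pgen h len)
    also have "\<dots> = ?c u v"
    proof -
      have add: "Modules.additive (pscale h :: ('d, 'l) Y \<Rightarrow> _)"
        by unfold_locales (rule pscale_add_right)
      show ?thesis
        by (simp add: u v bracket_limit_def bracket_correction_def poly_bracket_Var
            double_bracket_add double_bracket_additive[OF add])
    qed
    finally show ?thesis .
  qed
  interpret H: poisson_algebra pscale "Y_bracket_h h :: ('d, 'l) Y \<Rightarrow> _"
    by (rule poisson_algebra_Y_bracket_h[OF h])
  have "Y_bracket_h h = poly_bracket ?c"
    by (rule poly_bracket_unique[OF H.biderivation_axioms gens])
  then have "Y_bracket_h h = (\<lambda>x y :: ('d, 'l) Y. bracket_limit x y + pscale h (bracket_correction x y))"
    by (simp only: lim)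
  then show ?thesis
    by (rule fun_cong[THEN fun_cong])
qed

lemma poisson_algebra_bracket_limit:
  "poisson_algebra pscale (bracket_limit :: ('d, 'l) Y \<Rightarrow> ('d, 'l) Y \<Rightarrow> ('d, 'l) Y)"
proof (rule poisson_algebra_limit[OF biderivation_bracket_limit biderivation_bracket_correction])
  fix h :: complex assume h: "h \<noteq> 0"
  have "Y_bracket_h h = (\<lambda>x y :: ('d, 'l) Y. bracket_limit x y + pscale h (bracket_correction x y))"
    by (intro ext Y_bracket_h_eq[OF h])
  then show "poisson_algebra pscale
      (\<lambda>x y :: ('d, 'l) Y. bracket_limit x y + pscale h (bracket_correction x y))"
    by (rule subst) (rule poisson_algebra_Y_bracket_h[OF h])
qed

lemma tendsto_Y_bracket_h:
  "((\<lambda>h. Poly_Mapping.lookup (Y_bracket_h h x y) m)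
      \<longlongrightarrow> Poly_Mapping.lookup (bracket_limit x y) m) (at 0)"
proof (rule Lim_transform_eventually)
  let ?l = "\<lambda>p. Poly_Mapping.lookup p m :: complex"
  have "((\<lambda>h. ?l (bracket_limit x y) + h * ?l (bracket_correction x y))
      \<longlongrightarrow> ?l (bracket_limit x y) + 0 * ?l (bracket_correction x y)) (at 0)"
    by (intro tendsto_intros)
  then show "((\<lambda>h. ?l (bracket_limit x y) + h * ?l (bracket_correction x y))
      \<longlongrightarrow> ?l (bracket_limit x y)) (at 0)"
    by simp
  show "\<forall>\<^sub>F h in at 0. ?l (bracket_limit x y) + h * ?l (bracket_correction x y) =
      ?l (Y_bracket_h h x y)"
    by (simp add: eventually_at_filter Y_bracket_h_eq lookup_add)
qed


section \<open>The limit is the symmetric algebra\<close>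

definition to_sym :: "('d, 'l) Y \<Rightarrow> ('d, 'l) Sg" where
  "to_sym = poly_eval pscale (\<lambda>u. case u of Gen i j z \<Rightarrow> Var (i, j, z))"

definition from_sym :: "('d, 'l) Sg \<Rightarrow> ('d, 'l) Y" where
  "from_sym = poly_eval pscale (\<lambda>(i, j, z). Var (Gen i j z))"

lemma alg_hom_to_sym: "alg_hom pscale pscale to_sym"
  and alg_hom_from_sym: "alg_hom pscale pscale from_sym"
  unfolding to_sym_def from_sym_def
  by (rule comm_algebra.alg_hom_poly_eval[OF comm_algebra_pscale])+

lemma to_sym_Var [simp]: "to_sym (Var (Gen i j z)) = Var (i, j, z)"
  and from_sym_Var [simp]: "from_sym (Var (i, j, z)) = Var (Gen i j z)"
  by (simp_all add: to_sym_def from_sym_def comm_algebra.poly_eval_Var[OF comm_algebra_pscale])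

lemma from_to_sym [simp]: "from_sym (to_sym f) = f"
proof (induction f rule: mpoly_induct)
  case (Var v)
  then show ?case by (cases v) simp
qed (simp_all add: alg_hom_simps[OF alg_hom_to_sym] alg_hom_simps[OF alg_hom_from_sym])

lemma to_from_sym [simp]: "to_sym (from_sym f) = f"
proof (induction f rule: mpoly_induct)
  case (Var v)
  then show ?case by (cases v) simp
qed (simp_all add: alg_hom_simps[OF alg_hom_to_sym] alg_hom_simps[OF alg_hom_from_sym])

lemma bracket_limit_Gen:
  "bracket_limit (Var (Gen i j z)) (Var (Gen k l w)) =
     (if j = k \<and> last (letters z) = hd (letters w)
      then Var (Gen i l (Word (letters z @ tl (letters w)))) else 0)
   - (if l = i \<and> last (letters w) = hd (letters z)
      then Var (Gen k j (Word (letters w @ tl (letters z)))) else 0)"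
proof -
  have "letters z \<noteq> []" "letters w \<noteq> []"
    using letters[of z] letters[of w] by simp_all
  then show ?thesis
    by (simp add: bracket_limit_def poly_bracket_Var double_bracket_degenerate) (auto simp: pgen_def)
qed

lemma Sg_bracket_Var:
  "Sg_bracket (Var (i, j, z)) (Var (k, l, w)) =
     (if j = k \<and> last (letters z) = hd (letters w)
      then Var (i, l, Word (letters z @ tl (letters w))) else 0)
   - (if l = i \<and> last (letters w) = hd (letters z)
      then Var (k, j, Word (letters w @ tl (letters z))) else 0)"
proof -
  have pscale_1: "pscale 1 f = f" for f :: "'c \<Rightarrow>\<^sub>0 complex"
    by (rule poly_mapping_eqI) simp
  have 0: "unit_tensor i j 0 = 0" "sym_incl 0 = 0" for i j :: 'a
    by (simp_all add: unit_tensor_def sym_incl_def)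
  have sym_incl_diff: "sym_incl (x - y) = sym_incl x - sym_incl y" for x y :: "('a, 'b) g"
    using sym_incl_add[of "x - y" y] by (simp add: algebra_simps)
  show ?thesis
    by (simp add: Sg_bracket_def sym_bracket_def poly_bracket_Var g_lie_def g_mult_def
        bilinear_ext_single sym_incl_diff sym_incl_single word_prod_def unit_tensor_single pscale_1 0)
qed

text \<open>
  Both brackets are determined by their values on the generators, where they are the same
  merging of words.
\<close>

lemma to_sym_bracket_limit:
  fixes x y :: "('d, 'l) Y"
  shows "to_sym (bracket_limit x y) = Sg_bracket (to_sym x) (to_sym y)"
proof -
  let ?c = "\<lambda>u v :: ('d, 'l) generator. bracket_limit (Var u) (Var v)"
  have "biderivation pscale (\<lambda>x y :: ('d, 'l) Y. from_sym (Sg_bracket (to_sym x) (to_sym y)))"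
    unfolding Sg_bracket_def sym_bracket_def
    by (rule biderivation_transport[OF biderivation_poly_bracket comm_algebra_pscale
          alg_hom_to_sym alg_hom_from_sym from_to_sym])
  moreover have "from_sym (Sg_bracket (to_sym (Var u)) (to_sym (Var v))) = ?c u v" for u v :: "('d, 'l) generator"
  proof -
    have "from_sym (f - g) = from_sym f - from_sym g" for f g :: "('d, 'l) Sg"
      using alg_hom_simps(1)[OF alg_hom_from_sym, of "f - g" g] by (simp add: algebra_simps)
    then show ?thesis
      by (cases u; cases v) (simp add: bracket_limit_Gen Sg_bracket_Var alg_hom_0[OF alg_hom_from_sym])
  qed
  ultimately have "(\<lambda>x y :: ('d, 'l) Y. from_sym (Sg_bracket (to_sym x) (to_sym y))) = poly_bracket ?c"
    by (rule poly_bracket_unique)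
  moreover have "bracket_limit = poly_bracket ?c"
    by (rule poly_bracket_unique[OF biderivation_bracket_limit refl])
  ultimately have "bracket_limit = (\<lambda>x y :: ('d, 'l) Y. from_sym (Sg_bracket (to_sym x) (to_sym y)))"
    by (rule trans[OF _ sym, rotated])
  then have "bracket_limit x y = from_sym (Sg_bracket (to_sym x) (to_sym y))"
    by (rule fun_cong[THEN fun_cong])
  then show ?thesis by simp
qed

theorem proposition5p7:
  assumes "CARD('d::finite) \<ge> 1" and "CARD('l::finite) \<ge> 2"
  shows "(\<forall>h. h \<noteq> 0 \<longrightarrow>
            poisson_algebra pscale (Y_bracket_h h :: ('d, 'l) Y \<Rightarrow> ('d, 'l) Y \<Rightarrow> ('d, 'l) Y)) \<and>
         (Y_bracket_h 1 :: ('d, 'l) Y \<Rightarrow> ('d, 'l) Y \<Rightarrow> ('d, 'l) Y) = Y_bracket \<and>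
         (\<exists>br0 :: ('d, 'l) Y \<Rightarrow> ('d, 'l) Y \<Rightarrow> ('d, 'l) Y.
            (\<forall>x y m. ((\<lambda>h. Poly_Mapping.lookup (Y_bracket_h h x y) m)
                        \<longlongrightarrow> Poly_Mapping.lookup (br0 x y) m) (at 0)) \<and>
            poisson_algebra pscale br0 \<and>
            poisson_isomorphic pscale br0
              pscale (Sg_bracket :: ('d, 'l) Sg \<Rightarrow> ('d, 'l) Sg \<Rightarrow> ('d, 'l) Sg))"
proof (intro conjI exI allI impI)
  show "poisson_algebra pscale (Y_bracket_h h :: ('d, 'l) Y \<Rightarrow> ('d, 'l) Y \<Rightarrow> ('d, 'l) Y)"
    if "h \<noteq> 0" for h
    by (rule poisson_algebra_Y_bracket_h[OF that])
  show "(Y_bracket_h 1 :: ('d, 'l) Y \<Rightarrow> ('d, 'l) Y \<Rightarrow> ('d, 'l) Y) = Y_bracket"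
    by (intro ext) (simp add: Y_bracket_h_def inv_phi phi_1)
  show "((\<lambda>h. Poly_Mapping.lookup (Y_bracket_h h x y) m)
      \<longlongrightarrow> Poly_Mapping.lookup (bracket_limit x y) m) (at 0)" for x y :: "('d, 'l) Y" and m
    by (rule tendsto_Y_bracket_h)
  show "poisson_algebra pscale (bracket_limit :: ('d, 'l) Y \<Rightarrow> ('d, 'l) Y \<Rightarrow> ('d, 'l) Y)"
    by (rule poisson_algebra_bracket_limit)
  have bij: "bij (to_sym :: ('d, 'l) Y \<Rightarrow> ('d, 'l) Sg)"
    by (rule o_bij[of from_sym]) (simp_all add: fun_eq_iff)
  show "poisson_isomorphic pscale (bracket_limit :: ('d, 'l) Y \<Rightarrow> ('d, 'l) Y \<Rightarrow> ('d, 'l) Y)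
      pscale (Sg_bracket :: ('d, 'l) Sg \<Rightarrow> ('d, 'l) Sg \<Rightarrow> ('d, 'l) Sg)"
    unfolding poisson_isomorphic_def
    by (intro exI[of _ to_sym] conjI allI bij alg_hom_to_sym to_sym_bracket_limit)
qed

end
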